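(* Let $\mathcal{L}$ be a bounded first-order language, $F\subseteq\mathcal{L}$ upward closed with respect to $\sqsubseteq_{\mathcal{L}}$, $R_F=\min_{\sqsubseteq_{\mathcal{L}}}\{c_{\mathcal{L}}(\phi)\mid\phi\in F\}$ its representation, and $s$ a state. Then the representation of $F\cap\{\phi\in\mathcal{L}\mid s\models\phi\}$, namely $\min_{\sqsubseteq_{\mathcal{L}}}\{c_{\mathcal{L}}(\phi)\mid\phi\in F,\ s\models\phi\}$, equals $\min_{\sqsubseteq_{\mathcal{L}}}\bigcup_{\phi\in R_F}\mathcal{W}_{\mathcal{L}}(\phi,s)$.
   Context: Fix a first-order signature $\Sigma$ and a set of variables $V$. States are $s=((\mathcal{U},\mathcal{I}),\mu)$ with $(\mathcal{U},\mathcal{I})$ a $\Sigma$-structure with finite universe and $\mu$ an assignment of variables; satisfaction is standard ($\bot$ false, $\bigvee\bar\phi$/$\bigwedge\bar\phi$ disjunction/conjunction of a sequence, $\bigvee\epsilon\equiv\bot$). For finite $X\subseteq V$, $\mathfrak{S}_X$ is the set of permutations of $X$ and $\phi\pi$ replaces each free $x\in X$ by $\pi(x)$; $\mathfrak{S}_V$-closed means closed under such substitutions. For $\bar\phi=\langle\phi_1,\dots,\phi_n\rangle$: $[\bar\phi]=\{1,\dots,n\}$, $\phi_{-i}=\phi_{n-i+1}$. Bounded first-order languages (inductively, $X\subseteq V$ finite): $\mathcal{L}_A=A\cup\{\bot\}$ ($A$ finite $\mathfrak{S}_V$-closed set of formulas with free variables in $V$); $\mathcal{L}_1\vee\mathcal{L}_2$,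 $\mathcal{L}_1\wedge\mathcal{L}_2$ (formulas $\phi_1\circ\phi_2$, $\phi_i\in\mathcal{L}_i$); $\bigvee_k\mathcal{L}=\{\bigvee\bar\phi\mid|\bar\phi|\le k\}$; $\bigwedge_\omega\mathcal{L}=\{\bigwedge\bar\phi\mid\bar\phi\text{ nonempty}\}$; $\exists_X\mathcal{L}$, $\forall_X\mathcal{L}$, $\exists\forall_X\mathcal{L}$ (formulas $QX.\phi$, $\phi\in\mathcal{L}$, with $Q=\exists$, $Q=\forall$, $Q\in\{\exists,\forall\}$). Subsumption: $\phi\sqsubseteq_{\mathcal{L}_A}\psi$ iff $\phi=\bot$ or $\phi=\psi$; pointwise for binary connectives; $\bigvee\bar\phi\sqsubseteq\bigvee\bar\psi$ iff some injective $m:[\bar\phi]\to[\bar\psi]$ has $\phi_i\sqsubseteq\psi_{m(i)}$ for all $i$; $\bigwedge\bar\phi\sqsubseteq\bigwedge\bar\psi$ iff some $m:[\bar\psi]\to[\bar\phi]$ has $\phi_{m(i)}\sqsubseteq\psi_i$ for all $i$; $QX.\phi\sqsubseteq QX.\psi$ iff $\phi\sqsubseteq\psi\pi$ for some $\pi\in\mathfrak{S}_X$; in $\exists\forall_X\mathcal{L}$ also $\forall X.\phi\sqsubseteq\exists X.\psi$ iff $\phi\sqsubseteq\psi\pi$ for some $\pi$. $F$ is upward closed if $\phi\in F$, $\phi\sqsubseteq\psi$ imply $\psi\in F$. Canonicalization $c_{\mathcal{L}}$ and total order $\le_{\mathcal{L}}$ on canonical formulas (mutual induction; $\min_{\sqsubseteq}$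 = set of $\sqsubseteq$-minimal elements, $\min_{\le}$ = least element, $\mathrm{sort}_{\le}$ = ascending sort): $c_{\mathcal{L}_A}(\phi)=\phi$; $c(\phi_1\circ\phi_2)=c(\phi_1)\circ c(\phi_2)$; $c(\bigvee\bar\phi)=\bigvee\mathrm{sort}_{\le}\langle c(\phi_1),\dots,c(\phi_n)\rangle$; $c(\bigwedge\bar\phi)=\bigwedge\mathrm{sort}_{\le}(\min_{\sqsubseteq}\{c(\phi_1),\dots,c(\phi_n)\})$; $c(QX.\phi)=QX.\min_{\le}\{c(\phi\pi)\mid\pi\in\mathfrak{S}_X\}$. $\le_{\mathcal{L}_A}$ is any total order extending $\sqsubseteq_{\mathcal{L}_A}$; binary connectives lexicographic; $\bigvee\bar\phi\le\bigvee\bar\psi$ iff $\bar\phi$ is a suffix of $\bar\psi$ or at the first index $i$ counted from the end where they differ $\phi_{-i}<\psi_{-i}$; $\bigwedge\bar\phi\le\bigwedge\bar\psi$ iff $\bar\psi$ is a prefix of $\bar\phi$ or at the first index $i$ where they differ $\phi_i<\psi_i$; $QX.\phi\le QX.\psi$ iff $\phi\le\psi$, and $\forall X.\phi<\exists X.\psi$ in $\exists\forall_X\mathcal{L}$. Weaken operator: for canonical $\phi\in\mathcal{L}$ and state $s$, $\mathcal{W}_{\mathcal{L}}(\phi,s)=\min_{\sqsubseteq_{\mathcal{L}}}\{c_{\mathcal{L}}(\psi)\mid\psi\in\mathcal{L},\ \phi\sqsubseteq_{\mathcal{L}}\psi,\ s\models\psi\}$.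
   Formalization: Replacing free variables by a permutation of X is required to capture no variable, both in formulas of A (for all finite X in V) and in formulas of the language under each quantifier over X; with capture the claim fails, e.g. for ∀_{x,y}∃_{y} over the atoms p(a,b). *)

theory Defs
  imports "HOL-Combinatorics.Permutations" "HOL-Library.Multiset" "HOL-Library.Sublist"
begin

section \<open>First-order logic over a signature\<close>

text \<open>The symbols of a signature are those on which the arity maps are defined, so that a signature
  may have no function symbols, or no predicate symbols, although the symbol types are nonempty.\<close>

record ('f, 'p) signature =
  fun_arity :: "'f \<Rightarrow> nat option"
  pred_arity :: "'p \<Rightarrow> nat option"

datatype ('f, 'v) trm = Var 'v | Fun 'f "('f, 'v) trm list"

text \<open>\<open>Disj\<close> and \<open>Conj\<close> are the connectives on finite sequences; they are
  syntactically different from the binary connectives, and \<open>Disj []\<close> from \<open>Bot\<close>.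
  Quantifiers bind a set of variables.\<close>

datatype ('f, 'p, 'v) fm =
    Bot
  | Eql "('f, 'v) trm" "('f, 'v) trm"
  | Rel 'p "('f, 'v) trm list"
  | Neg "('f, 'p, 'v) fm"
  | Imp "('f, 'p, 'v) fm" "('f, 'p, 'v) fm"
  | Or "('f, 'p, 'v) fm" "('f, 'p, 'v) fm"
  | And "('f, 'p, 'v) fm" "('f, 'p, 'v) fm"
  | Disj "('f, 'p, 'v) fm list"
  | Conj "('f, 'p, 'v) fm list"
  | Exists "'v set" "('f, 'p, 'v) fm"
  | Forall "'v set" "('f, 'p, 'v) fm"

fun is_term :: "('f, 'p) signature \<Rightarrow> ('f, 'v) trm \<Rightarrow> bool" where
  "is_term S (Var x) \<longleftrightarrow> True"
| "is_term S (Fun f ts) \<longleftrightarrow> fun_arity S f = Some (length ts) \<and> (\<forall>t\<in>set ts. is_term S t)"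

fun is_formula :: "('f, 'p) signature \<Rightarrow> ('f, 'p, 'v) fm \<Rightarrow> bool" where
  "is_formula S Bot \<longleftrightarrow> True"
| "is_formula S (Eql t u) \<longleftrightarrow> is_term S t \<and> is_term S u"
| "is_formula S (Rel p ts) \<longleftrightarrow> pred_arity S p = Some (length ts) \<and> (\<forall>t\<in>set ts. is_term S t)"
| "is_formula S (Neg \<phi>) \<longleftrightarrow> is_formula S \<phi>"
| "is_formula S (Imp \<phi> \<psi>) \<longleftrightarrow> is_formula S \<phi> \<and> is_formula S \<psi>"
| "is_formula S (Or \<phi> \<psi>) \<longleftrightarrow> is_formula S \<phi> \<and> is_formula S \<psi>"
| "is_formula S (And \<phi> \<psi>) \<longleftrightarrow> is_formula S \<phi> \<and> is_formula S \<psi>"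
| "is_formula S (Disj \<phi>s) \<longleftrightarrow> (\<forall>\<phi>\<in>set \<phi>s. is_formula S \<phi>)"
| "is_formula S (Conj \<phi>s) \<longleftrightarrow> (\<forall>\<phi>\<in>set \<phi>s. is_formula S \<phi>)"
| "is_formula S (Exists X \<phi>) \<longleftrightarrow> finite X \<and> is_formula S \<phi>"
| "is_formula S (Forall X \<phi>) \<longleftrightarrow> finite X \<and> is_formula S \<phi>"

fun tvars :: "('f, 'v) trm \<Rightarrow> 'v set" where
  "tvars (Var x) = {x}"
| "tvars (Fun f ts) = (\<Union>t\<in>set ts. tvars t)"

fun fv :: "('f, 'p, 'v) fm \<Rightarrow> 'v set" where
  "fv Bot = {}"
| "fv (Eql t u) = tvars t \<union> tvars u"
| "fv (Rel p ts) = (\<Union>t\<in>set ts. tvars t)"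
| "fv (Neg \<phi>) = fv \<phi>"
| "fv (Imp \<phi> \<psi>) = fv \<phi> \<union> fv \<psi>"
| "fv (Or \<phi> \<psi>) = fv \<phi> \<union> fv \<psi>"
| "fv (And \<phi> \<psi>) = fv \<phi> \<union> fv \<psi>"
| "fv (Disj \<phi>s) = (\<Union>\<phi>\<in>set \<phi>s. fv \<phi>)"
| "fv (Conj \<phi>s) = (\<Union>\<phi>\<in>set \<phi>s. fv \<phi>)"
| "fv (Exists X \<phi>) = fv \<phi> - X"
| "fv (Forall X \<phi>) = fv \<phi> - X"

subsection \<open>States and satisfaction\<close>

record ('f, 'p, 'u) struct =
  universe :: "'u set"
  fun_interp :: "'f \<Rightarrow> 'u list \<Rightarrow> 'u"
  pred_interp :: "'p \<Rightarrow> 'u list \<Rightarrow> bool"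

type_synonym ('f, 'p, 'v, 'u) state = "('f, 'p, 'u) struct \<times> ('v \<Rightarrow> 'u)"

definition is_structure :: "('f, 'p) signature \<Rightarrow> ('f, 'p, 'u) struct \<Rightarrow> bool" where
  "is_structure S M \<longleftrightarrow> universe M \<noteq> {} \<and>
     (\<forall>f us. fun_arity S f = Some (length us) \<and> set us \<subseteq> universe M
        \<longrightarrow> fun_interp M f us \<in> universe M)"

definition is_state :: "('f, 'p) signature \<Rightarrow> 'v set \<Rightarrow> ('f, 'p, 'v, 'u) state \<Rightarrow> bool" where
  "is_state S V s \<longleftrightarrow>
     is_structure S (fst s) \<and> finite (universe (fst s)) \<and> (\<forall>x\<in>V. snd s x \<in> universe (fst s))"

fun teval :: "('f, 'p, 'u) struct \<Rightarrow> ('v \<Rightarrow> 'u) \<Rightarrow> ('f, 'v) trm \<Rightarrow> 'u" where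
  "teval M \<mu> (Var x) = \<mu> x"
| "teval M \<mu> (Fun f ts) = fun_interp M f (map (teval M \<mu>) ts)"

definition reassign :: "('f, 'p, 'u) struct \<Rightarrow> 'v set \<Rightarrow> ('v \<Rightarrow> 'u) \<Rightarrow> ('v \<Rightarrow> 'u) set" where
  "reassign M X \<mu> = {\<nu>. (\<forall>x\<in>X. \<nu> x \<in> universe M) \<and> (\<forall>x. x \<notin> X \<longrightarrow> \<nu> x = \<mu> x)}"

fun holds :: "('f, 'p, 'u) struct \<Rightarrow> ('v \<Rightarrow> 'u) \<Rightarrow> ('f, 'p, 'v) fm \<Rightarrow> bool" where
  "holds M \<mu> Bot \<longleftrightarrow> False"
| "holds M \<mu> (Eql t u) \<longleftrightarrow> teval M \<mu> t = teval M \<mu> u"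
| "holds M \<mu> (Rel p ts) \<longleftrightarrow> pred_interp M p (map (teval M \<mu>) ts)"
| "holds M \<mu> (Neg \<phi>) \<longleftrightarrow> \<not> holds M \<mu> \<phi>"
| "holds M \<mu> (Imp \<phi> \<psi>) \<longleftrightarrow> (holds M \<mu> \<phi> \<longrightarrow> holds M \<mu> \<psi>)"
| "holds M \<mu> (Or \<phi> \<psi>) \<longleftrightarrow> holds M \<mu> \<phi> \<or> holds M \<mu> \<psi>"
| "holds M \<mu> (And \<phi> \<psi>) \<longleftrightarrow> holds M \<mu> \<phi> \<and> holds M \<mu> \<psi>"
| "holds M \<mu> (Disj \<phi>s) \<longleftrightarrow> (\<exists>\<phi>\<in>set \<phi>s. holds M \<mu> \<phi>)"
| "holds M \<mu> (Conj \<phi>s) \<longleftrightarrow> (\<forall>\<phi>\<in>set \<phi>s. holds M \<mu> \<phi>)"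
| "holds M \<mu> (Exists X \<phi>) \<longleftrightarrow> (\<exists>\<nu>\<in>reassign M X \<mu>. holds M \<nu> \<phi>)"
| "holds M \<mu> (Forall X \<phi>) \<longleftrightarrow> (\<forall>\<nu>\<in>reassign M X \<mu>. holds M \<nu> \<phi>)"

definition sat :: "('f, 'p, 'v, 'u) state \<Rightarrow> ('f, 'p, 'v) fm \<Rightarrow> bool" (infix "\<Turnstile>" 50) where
  "s \<Turnstile> \<phi> \<longleftrightarrow> holds (fst s) (snd s) \<phi>"

subsection \<open>Renaming of free variables\<close>

definition fix_on :: "'v set \<Rightarrow> ('v \<Rightarrow> 'v) \<Rightarrow> 'v \<Rightarrow> 'v" where
  "fix_on X \<pi> = (\<lambda>x. if x \<in> X then x else \<pi> x)"

fun rename_trm :: "('v \<Rightarrow> 'v) \<Rightarrow> ('f, 'v) trm \<Rightarrow> ('f, 'v) trm" where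
  "rename_trm \<pi> (Var x) = Var (\<pi> x)"
| "rename_trm \<pi> (Fun f ts) = Fun f (map (rename_trm \<pi>) ts)"

text \<open>Only free occurrences are replaced, and bound variables are never renamed. The result is the
  intended one exactly when no replaced occurrence gets captured; this is the usual side condition
  \<open>free_for\<close>.\<close>

fun rename :: "('v \<Rightarrow> 'v) \<Rightarrow> ('f, 'p, 'v) fm \<Rightarrow> ('f, 'p, 'v) fm" where
  "rename \<pi> Bot = Bot"
| "rename \<pi> (Eql t u) = Eql (rename_trm \<pi> t) (rename_trm \<pi> u)"
| "rename \<pi> (Rel p ts) = Rel p (map (rename_trm \<pi>) ts)"
| "rename \<pi> (Neg \<phi>) = Neg (rename \<pi> \<phi>)"
| "rename \<pi> (Imp \<phi> \<psi>) = Imp (rename \<pi> \<phi>) (rename \<pi> \<psi>)"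
| "rename \<pi> (Or \<phi> \<psi>) = Or (rename \<pi> \<phi>) (rename \<pi> \<psi>)"
| "rename \<pi> (And \<phi> \<psi>) = And (rename \<pi> \<phi>) (rename \<pi> \<psi>)"
| "rename \<pi> (Disj \<phi>s) = Disj (map (rename \<pi>) \<phi>s)"
| "rename \<pi> (Conj \<phi>s) = Conj (map (rename \<pi>) \<phi>s)"
| "rename \<pi> (Exists X \<phi>) = Exists X (rename (fix_on X \<pi>) \<phi>)"
| "rename \<pi> (Forall X \<phi>) = Forall X (rename (fix_on X \<pi>) \<phi>)"

fun free_for :: "('v \<Rightarrow> 'v) \<Rightarrow> ('f, 'p, 'v) fm \<Rightarrow> bool" where
  "free_for \<pi> Bot \<longleftrightarrow> True"
| "free_for \<pi> (Eql t u) \<longleftrightarrow> True"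
| "free_for \<pi> (Rel p ts) \<longleftrightarrow> True"
| "free_for \<pi> (Neg \<phi>) \<longleftrightarrow> free_for \<pi> \<phi>"
| "free_for \<pi> (Imp \<phi> \<psi>) \<longleftrightarrow> free_for \<pi> \<phi> \<and> free_for \<pi> \<psi>"
| "free_for \<pi> (Or \<phi> \<psi>) \<longleftrightarrow> free_for \<pi> \<phi> \<and> free_for \<pi> \<psi>"
| "free_for \<pi> (And \<phi> \<psi>) \<longleftrightarrow> free_for \<pi> \<phi> \<and> free_for \<pi> \<psi>"
| "free_for \<pi> (Disj \<phi>s) \<longleftrightarrow> (\<forall>\<phi>\<in>set \<phi>s. free_for \<pi> \<phi>)"
| "free_for \<pi> (Conj \<phi>s) \<longleftrightarrow> (\<forall>\<phi>\<in>set \<phi>s. free_for \<pi> \<phi>)"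
| "free_for \<pi> (Exists X \<phi>) \<longleftrightarrow> (\<forall>x\<in>fv \<phi> - X. \<pi> x \<notin> X) \<and> free_for (fix_on X \<pi>) \<phi>"
| "free_for \<pi> (Forall X \<phi>) \<longleftrightarrow> (\<forall>x\<in>fv \<phi> - X. \<pi> x \<notin> X) \<and> free_for (fix_on X \<pi>) \<phi>"

section \<open>Bounded first-order languages\<close>

text \<open>Subsumption, canonicalization and the orders depend on how a language is built and not only on
  its set of formulas; so languages are syntactic objects, and \<open>formulas\<close> gives the set of
  formulas.\<close>

datatype ('f, 'p, 'v) lang =
    LBase "('f, 'p, 'v) fm set"
  | LOr "('f, 'p, 'v) lang" "('f, 'p, 'v) lang"
  | LAnd "('f, 'p, 'v) lang" "('f, 'p, 'v) lang"
  | LDisj nat "('f, 'p, 'v) lang"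
  | LConj "('f, 'p, 'v) lang"
  | LExists "'v set" "('f, 'p, 'v) lang"
  | LForall "'v set" "('f, 'p, 'v) lang"
  | LExFa "'v set" "('f, 'p, 'v) lang"

primrec formulas :: "('f, 'p, 'v) lang \<Rightarrow> ('f, 'p, 'v) fm set" where
  "formulas (LBase A) = A \<union> {Bot}"
| "formulas (LOr L1 L2) = {Or \<phi> \<psi> |\<phi> \<psi>. \<phi> \<in> formulas L1 \<and> \<psi> \<in> formulas L2}"
| "formulas (LAnd L1 L2) = {And \<phi> \<psi> |\<phi> \<psi>. \<phi> \<in> formulas L1 \<and> \<psi> \<in> formulas L2}"
| "formulas (LDisj k L) = {Disj \<phi>s |\<phi>s. set \<phi>s \<subseteq> formulas L \<and> length \<phi>s \<le> k}"
| "formulas (LConj L) = {Conj \<phi>s |\<phi>s. set \<phi>s \<subseteq> formulas L \<and> \<phi>s \<noteq> []}"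
| "formulas (LExists X L) = {Exists X \<phi> |\<phi>. \<phi> \<in> formulas L}"
| "formulas (LForall X L) = {Forall X \<phi> |\<phi>. \<phi> \<in> formulas L}"
| "formulas (LExFa X L) = {Exists X \<phi> |\<phi>. \<phi> \<in> formulas L} \<union> {Forall X \<phi> |\<phi>. \<phi> \<in> formulas L}"

definition base_set :: "('f, 'p) signature \<Rightarrow> 'v set \<Rightarrow> ('f, 'p, 'v) fm set \<Rightarrow> bool" where
  "base_set S V A \<longleftrightarrow> finite A \<and> (\<forall>\<phi>\<in>A. is_formula S \<phi> \<and> fv \<phi> \<subseteq> V) \<and>
     (\<forall>\<phi>\<in>A. \<forall>X \<pi>. finite X \<and> X \<subseteq> V \<and> \<pi> permutes X \<longrightarrow> free_for \<pi> \<phi> \<and> rename \<pi> \<phi> \<in> A)"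

text \<open>A quantifier over \<open>X\<close> is applied only to languages in whose formulas renaming by
  permutations of \<open>X\<close> captures no variable. It suffices for this that every set
  quantified in building the inner language is disjoint from \<open>X\<close> or includes \<open>X\<close>. Otherwise renaming is not
  an action of the permutations of \<open>X\<close>, and a formula need not be equivalent to its canonical
  form.\<close>

definition renamable :: "'v set \<Rightarrow> ('f, 'p, 'v) lang \<Rightarrow> bool" where
  "renamable X L \<longleftrightarrow> (\<forall>\<phi>\<in>formulas L. \<forall>\<pi>. \<pi> permutes X \<longrightarrow> free_for \<pi> \<phi>)"

primrec bounded_language :: "('f, 'p) signature \<Rightarrow> 'v set \<Rightarrow> ('f, 'p, 'v) lang \<Rightarrow> bool" where
  "bounded_language S V (LBase A) \<longleftrightarrow> base_set S V A"
| "bounded_language S V (LOr L1 L2) \<longleftrightarrow> bounded_language S V L1 \<and> bounded_language S V L2"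
| "bounded_language S V (LAnd L1 L2) \<longleftrightarrow> bounded_language S V L1 \<and> bounded_language S V L2"
| "bounded_language S V (LDisj k L) \<longleftrightarrow> bounded_language S V L"
| "bounded_language S V (LConj L) \<longleftrightarrow> bounded_language S V L"
| "bounded_language S V (LExists X L) \<longleftrightarrow>
     finite X \<and> X \<subseteq> V \<and> renamable X L \<and> bounded_language S V L"
| "bounded_language S V (LForall X L) \<longleftrightarrow>
     finite X \<and> X \<subseteq> V \<and> renamable X L \<and> bounded_language S V L"
| "bounded_language S V (LExFa X L) \<longleftrightarrow>
     finite X \<and> X \<subseteq> V \<and> renamable X L \<and> bounded_language S V L"

section \<open>Subsumption\<close>

text \<open>The relations below are meant on the formulas of the language only.\<close>

primrec subsumes :: "('f, 'p, 'v) lang \<Rightarrow> ('f, 'p, 'v) fm \<Rightarrow> ('f, 'p, 'v) fm \<Rightarrow> bool" where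
  "subsumes (LBase A) = (\<lambda>\<phi> \<psi>. \<phi> = Bot \<or> \<phi> = \<psi>)"
| "subsumes (LOr L1 L2) = (\<lambda>\<phi> \<psi>. \<exists>\<phi>1 \<phi>2 \<psi>1 \<psi>2. \<phi> = Or \<phi>1 \<phi>2 \<and> \<psi> = Or \<psi>1 \<psi>2 \<and>
     subsumes L1 \<phi>1 \<psi>1 \<and> subsumes L2 \<phi>2 \<psi>2)"
| "subsumes (LAnd L1 L2) = (\<lambda>\<phi> \<psi>. \<exists>\<phi>1 \<phi>2 \<psi>1 \<psi>2. \<phi> = And \<phi>1 \<phi>2 \<and> \<psi> = And \<psi>1 \<psi>2 \<and>
     subsumes L1 \<phi>1 \<psi>1 \<and> subsumes L2 \<phi>2 \<psi>2)"
| "subsumes (LDisj k L) = (\<lambda>\<phi> \<psi>. \<exists>\<phi>s \<psi>s m. \<phi> = Disj \<phi>s \<and> \<psi> = Disj \<psi>s \<and>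
     inj_on m {..<length \<phi>s} \<and> m ` {..<length \<phi>s} \<subseteq> {..<length \<psi>s} \<and>
     (\<forall>i<length \<phi>s. subsumes L (\<phi>s ! i) (\<psi>s ! m i)))"
| "subsumes (LConj L) = (\<lambda>\<phi> \<psi>. \<exists>\<phi>s \<psi>s m. \<phi> = Conj \<phi>s \<and> \<psi> = Conj \<psi>s \<and>
     m ` {..<length \<psi>s} \<subseteq> {..<length \<phi>s} \<and>
     (\<forall>i<length \<psi>s. subsumes L (\<phi>s ! m i) (\<psi>s ! i)))"
| "subsumes (LExists X L) = (\<lambda>\<phi> \<psi>. \<exists>\<phi>' \<psi>' \<pi>. \<phi> = Exists X \<phi>' \<and> \<psi> = Exists X \<psi>' \<and>
     \<pi> permutes X \<and> subsumes L \<phi>' (rename \<pi> \<psi>'))"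
| "subsumes (LForall X L) = (\<lambda>\<phi> \<psi>. \<exists>\<phi>' \<psi>' \<pi>. \<phi> = Forall X \<phi>' \<and> \<psi> = Forall X \<psi>' \<and>
     \<pi> permutes X \<and> subsumes L \<phi>' (rename \<pi> \<psi>'))"
| "subsumes (LExFa X L) = (\<lambda>\<phi> \<psi>. \<exists>\<phi>' \<psi>' \<pi>.
     (\<phi> = Exists X \<phi>' \<and> \<psi> = Exists X \<psi>' \<or> \<phi> = Forall X \<phi>' \<and> \<psi> = Forall X \<psi>' \<or>
      \<phi> = Forall X \<phi>' \<and> \<psi> = Exists X \<psi>') \<and>
     \<pi> permutes X \<and> subsumes L \<phi>' (rename \<pi> \<psi>'))"

definition upward_closed :: "('f, 'p, 'v) lang \<Rightarrow> ('f, 'p, 'v) fm set \<Rightarrow> bool" where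
  "upward_closed L F \<longleftrightarrow> (\<forall>\<phi>\<in>F. \<forall>\<psi>\<in>formulas L. subsumes L \<phi> \<psi> \<longrightarrow> \<psi> \<in> F)"

section \<open>Canonicalization\<close>

text \<open>The parameter \<open>ord\<close> supplies the chosen total order on each base language.\<close>

definition is_base_order :: "('f, 'p, 'v) fm set \<Rightarrow> ('f, 'p, 'v) fm rel \<Rightarrow> bool" where
  "is_base_order A r \<longleftrightarrow> linear_order_on (formulas (LBase A)) r \<and>
     (\<forall>\<phi>\<in>formulas (LBase A). \<forall>\<psi>\<in>formulas (LBase A). subsumes (LBase A) \<phi> \<psi> \<longrightarrow> (\<phi>, \<psi>) \<in> r)"

definition lex2 :: "('a \<Rightarrow> 'a \<Rightarrow> bool) \<Rightarrow> ('b \<Rightarrow> 'b \<Rightarrow> bool) \<Rightarrow> 'a \<Rightarrow> 'b \<Rightarrow> 'a \<Rightarrow> 'b \<Rightarrow> bool" where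
  "lex2 le1 le2 a b a' b' \<longleftrightarrow> (le1 a a' \<and> a \<noteq> a') \<or> (a = a' \<and> le2 b b')"

definition first_diff_less :: "('a \<Rightarrow> 'a \<Rightarrow> bool) \<Rightarrow> 'a list \<Rightarrow> 'a list \<Rightarrow> bool" where
  "first_diff_less le xs ys \<longleftrightarrow> (\<exists>i. i < length xs \<and> i < length ys \<and> take i xs = take i ys \<and>
     xs ! i \<noteq> ys ! i \<and> le (xs ! i) (ys ! i))"

primrec leq :: "(('f, 'p, 'v) fm set \<Rightarrow> ('f, 'p, 'v) fm rel) \<Rightarrow> ('f, 'p, 'v) lang \<Rightarrow>
    ('f, 'p, 'v) fm \<Rightarrow> ('f, 'p, 'v) fm \<Rightarrow> bool" where
  "leq ord (LBase A) = (\<lambda>\<phi> \<psi>. (\<phi>, \<psi>) \<in> ord A)"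
| "leq ord (LOr L1 L2) = (\<lambda>\<phi> \<psi>. \<exists>\<phi>1 \<phi>2 \<psi>1 \<psi>2. \<phi> = Or \<phi>1 \<phi>2 \<and> \<psi> = Or \<psi>1 \<psi>2 \<and>
     lex2 (leq ord L1) (leq ord L2) \<phi>1 \<phi>2 \<psi>1 \<psi>2)"
| "leq ord (LAnd L1 L2) = (\<lambda>\<phi> \<psi>. \<exists>\<phi>1 \<phi>2 \<psi>1 \<psi>2. \<phi> = And \<phi>1 \<phi>2 \<and> \<psi> = And \<psi>1 \<psi>2 \<and>
     lex2 (leq ord L1) (leq ord L2) \<phi>1 \<phi>2 \<psi>1 \<psi>2)"
| "leq ord (LDisj k L) = (\<lambda>\<phi> \<psi>. \<exists>\<phi>s \<psi>s. \<phi> = Disj \<phi>s \<and> \<psi> = Disj \<psi>s \<and>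
     (suffix \<phi>s \<psi>s \<or> first_diff_less (leq ord L) (rev \<phi>s) (rev \<psi>s)))"
| "leq ord (LConj L) = (\<lambda>\<phi> \<psi>. \<exists>\<phi>s \<psi>s. \<phi> = Conj \<phi>s \<and> \<psi> = Conj \<psi>s \<and>
     (prefix \<psi>s \<phi>s \<or> first_diff_less (leq ord L) \<phi>s \<psi>s))"
| "leq ord (LExists X L) = (\<lambda>\<phi> \<psi>. \<exists>\<phi>' \<psi>'. \<phi> = Exists X \<phi>' \<and> \<psi> = Exists X \<psi>' \<and> leq ord L \<phi>' \<psi>')"
| "leq ord (LForall X L) = (\<lambda>\<phi> \<psi>. \<exists>\<phi>' \<psi>'. \<phi> = Forall X \<phi>' \<and> \<psi> = Forall X \<psi>' \<and> leq ord L \<phi>' \<psi>')"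
| "leq ord (LExFa X L) = (\<lambda>\<phi> \<psi>. \<exists>\<phi>' \<psi>'.
     \<phi> = Exists X \<phi>' \<and> \<psi> = Exists X \<psi>' \<and> leq ord L \<phi>' \<psi>' \<or>
     \<phi> = Forall X \<phi>' \<and> \<psi> = Forall X \<psi>' \<and> leq ord L \<phi>' \<psi>' \<or>
     \<phi> = Forall X \<phi>' \<and> \<psi> = Exists X \<psi>')"

text \<open>On formulas of the language that are not canonical, \<open>subsumes L\<close> is only a preorder; hence
  minimality is stated in the form for preorders.\<close>

definition minimal :: "('a \<Rightarrow> 'a \<Rightarrow> bool) \<Rightarrow> 'a set \<Rightarrow> 'a set" where
  "minimal le B = {x \<in> B. \<forall>y\<in>B. le y x \<longrightarrow> le x y}"

definition least :: "('a \<Rightarrow> 'a \<Rightarrow> bool) \<Rightarrow> 'a set \<Rightarrow> 'a" where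
  "least le B = (THE x. x \<in> B \<and> (\<forall>y\<in>B. le x y))"

definition ascending :: "('a \<Rightarrow> 'a \<Rightarrow> bool) \<Rightarrow> 'a multiset \<Rightarrow> 'a list" where
  "ascending le M = (THE xs. mset xs = M \<and> sorted_wrt le xs)"

primrec canon :: "(('f, 'p, 'v) fm set \<Rightarrow> ('f, 'p, 'v) fm rel) \<Rightarrow> ('f, 'p, 'v) lang \<Rightarrow>
    ('f, 'p, 'v) fm \<Rightarrow> ('f, 'p, 'v) fm" where
  "canon ord (LBase A) = (\<lambda>\<phi>. \<phi>)"
| "canon ord (LOr L1 L2) = (\<lambda>\<phi>. case \<phi> of
     Or \<phi>1 \<phi>2 \<Rightarrow> Or (canon ord L1 \<phi>1) (canon ord L2 \<phi>2) | _ \<Rightarrow> \<phi>)"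
| "canon ord (LAnd L1 L2) = (\<lambda>\<phi>. case \<phi> of
     And \<phi>1 \<phi>2 \<Rightarrow> And (canon ord L1 \<phi>1) (canon ord L2 \<phi>2) | _ \<Rightarrow> \<phi>)"
| "canon ord (LDisj k L) = (\<lambda>\<phi>. case \<phi> of
     Disj \<phi>s \<Rightarrow> Disj (ascending (leq ord L) (mset (map (canon ord L) \<phi>s))) | _ \<Rightarrow> \<phi>)"
| "canon ord (LConj L) = (\<lambda>\<phi>. case \<phi> of
     Conj \<phi>s \<Rightarrow>
       Conj (ascending (leq ord L) (mset_set (minimal (subsumes L) (canon ord L ` set \<phi>s)))) | _ \<Rightarrow> \<phi>)"
| "canon ord (LExists X L) = (\<lambda>\<phi>. case \<phi> of
     Exists Y \<phi>' \<Rightarrow> Exists Y (least (leq ord L) {canon ord L (rename \<pi> \<phi>') |\<pi>. \<pi> permutes X}) | _ \<Rightarrow> \<phi>)"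
| "canon ord (LForall X L) = (\<lambda>\<phi>. case \<phi> of
     Forall Y \<phi>' \<Rightarrow> Forall Y (least (leq ord L) {canon ord L (rename \<pi> \<phi>') |\<pi>. \<pi> permutes X}) | _ \<Rightarrow> \<phi>)"
| "canon ord (LExFa X L) = (\<lambda>\<phi>. case \<phi> of
     Exists Y \<phi>' \<Rightarrow> Exists Y (least (leq ord L) {canon ord L (rename \<pi> \<phi>') |\<pi>. \<pi> permutes X})
   | Forall Y \<phi>' \<Rightarrow> Forall Y (least (leq ord L) {canon ord L (rename \<pi> \<phi>') |\<pi>. \<pi> permutes X})
   | _ \<Rightarrow> \<phi>)"

section \<open>Representations and the weaken operator\<close>

definition representation :: "(('f, 'p, 'v) fm set \<Rightarrow> ('f, 'p, 'v) fm rel) \<Rightarrow> ('f, 'p, 'v) lang \<Rightarrow>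
    ('f, 'p, 'v) fm set \<Rightarrow> ('f, 'p, 'v) fm set" where
  "representation ord L F = minimal (subsumes L) {canon ord L \<phi> |\<phi>. \<phi> \<in> F}"

definition weaken :: "(('f, 'p, 'v) fm set \<Rightarrow> ('f, 'p, 'v) fm rel) \<Rightarrow> ('f, 'p, 'v) lang \<Rightarrow>
    ('f, 'p, 'v) fm \<Rightarrow> ('f, 'p, 'v, 'u) state \<Rightarrow> ('f, 'p, 'v) fm set" where
  "weaken ord L \<phi> s =
     minimal (subsumes L) {canon ord L \<psi> |\<psi>. \<psi> \<in> formulas L \<and> subsumes L \<phi> \<psi> \<and> s \<Turnstile> \<psi>}"

end

theory Submission
  imports Defs
begin

text \<open>On the formulas of a bounded language, \<open>subsumes L\<close> is a preorder, a formula and its canonical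
  form subsume each other, and there are only finitely many canonical forms. Hence an upward closed
  \<open>F\<close> contains its representation, and every canonical form of a formula in \<open>F\<close> lies above an
  element of it. The union of the weakened sets thus lies between
  \<open>{canon ord L \<phi> |\<phi>. \<phi> \<in> F, s \<Turnstile> \<phi>}\<close> and the set of its minimal elements, so
  that both have the same minimal elements.\<close>

section \<open>Renaming\<close>

text \<open>The obstacle lies under the quantifiers. Subsumption holds there up to a permutation, so
  to compose the relation of \<open>\<phi>\<close> to \<open>rename \<pi> \<psi>\<close> with that
  of \<open>\<psi>\<close> to \<open>rename \<rho> \<chi>\<close> one has to apply
  \<open>\<pi>\<close> to the second one: transitivity rests on invariance of subsumption under
  renaming. An inner quantifier over \<open>X\<close> turns \<open>f\<close> into
  \<open>fix_on X f\<close>, so the invariance is proved for all injective renamings without capture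
  and not only for permutations. Finiteness of the set of canonical forms is not obvious either,
  because conjunctions have unbounded length. It holds because a canonical conjunction is determined
  by the set of the canonical forms of its conjuncts. Finiteness is also what makes the last step of
  the argument work: every element of a finite preordered set has a minimal one below it, and
  therefore any set lying between \<open>B\<close> and its minimal elements has exactly the minimal
  elements of \<open>B\<close>.\<close>

lemma finite_tvars: "finite (tvars t)"
  by (induction t) auto

lemma finite_fv: "finite (fv \<phi>)"
  by (induction \<phi>) (auto simp: finite_tvars)

lemma rename_trm_cong: "(\<And>x. x \<in> tvars t \<Longrightarrow> f x = g x) \<Longrightarrow> rename_trm f t = rename_trm g t"
  by (induction t) auto

lemma tvars_rename_trm: "tvars (rename_trm f t) = f ` tvars t"
  by (induction t) auto

lemma rename_trm_comp: "rename_trm g (rename_trm f t) = rename_trm (g \<circ> f) t"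
  by (induction t) auto

lemma rename_trm_id: "rename_trm (\<lambda>x. x) t = t"
  by (induction t) (auto simp: map_idI)

lemma fix_on_id: "fix_on X (\<lambda>x. x) = (\<lambda>x. x)"
  by (auto simp: fix_on_def)

lemma rename_id: "rename (\<lambda>x. x) \<phi> = \<phi>"
  by (induction \<phi>) (auto simp: rename_trm_id fix_on_id map_idI)

lemma rename_cong: "(\<And>x. x \<in> fv \<phi> \<Longrightarrow> f x = g x) \<Longrightarrow> rename f \<phi> = rename g \<phi>"
proof (induction \<phi> arbitrary: f g)
  case (Exists X \<phi>)
  have "rename (fix_on X f) \<phi> = rename (fix_on X g) \<phi>"
    by (rule Exists.IH) (use Exists.prems in \<open>auto simp: fix_on_def\<close>)
  then show ?case by simp
next
  case (Forall X \<phi>)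
  have "rename (fix_on X f) \<phi> = rename (fix_on X g) \<phi>"
    by (rule Forall.IH) (use Forall.prems in \<open>auto simp: fix_on_def\<close>)
  then show ?case by simp
next
  case (Eql t u)
  then show ?case by (simp add: rename_trm_cong[of _ f g])
next
  case (Rel p ts)
  then show ?case by (auto intro: rename_trm_cong)
next
  case (Neg \<phi>)
  from Neg.IH[of f g] Neg.prems show ?case by simp
next
  case (Imp \<phi> \<psi>)
  from Imp.IH(1)[of f g] Imp.IH(2)[of f g] Imp.prems show ?case by simp
next
  case (Or \<phi> \<psi>)
  from Or.IH(1)[of f g] Or.IH(2)[of f g] Or.prems show ?case by simp
next
  case (And \<phi> \<psi>)
  from And.IH(1)[of f g] And.IH(2)[of f g] And.prems show ?case by simp
next
  case (Disj \<phi>s)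
  from Disj.IH[of _ f g] Disj.prems show ?case by force
next
  case (Conj \<phi>s)
  from Conj.IH[of _ f g] Conj.prems show ?case by force
qed simp

lemma free_for_cong: "(\<And>x. x \<in> fv \<phi> \<Longrightarrow> f x = g x) \<Longrightarrow> free_for f \<phi> \<longleftrightarrow> free_for g \<phi>"
proof (induction \<phi> arbitrary: f g)
  case (Exists X \<phi>)
  have "free_for (fix_on X f) \<phi> = free_for (fix_on X g) \<phi>"
    by (rule Exists.IH) (use Exists.prems in \<open>auto simp: fix_on_def\<close>)
  then show ?case using Exists.prems by simp
next
  case (Forall X \<phi>)
  have "free_for (fix_on X f) \<phi> = free_for (fix_on X g) \<phi>"
    by (rule Forall.IH) (use Forall.prems in \<open>auto simp: fix_on_def\<close>)
  then show ?case using Forall.prems by simp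
next
  case (Neg \<phi>)
  from Neg.IH[of f g] Neg.prems show ?case by simp
next
  case (Imp \<phi> \<psi>)
  from Imp.IH(1)[of f g] Imp.IH(2)[of f g] Imp.prems show ?case by simp
next
  case (Or \<phi> \<psi>)
  from Or.IH(1)[of f g] Or.IH(2)[of f g] Or.prems show ?case by simp
next
  case (And \<phi> \<psi>)
  from And.IH(1)[of f g] And.IH(2)[of f g] And.prems show ?case by simp
next
  case (Disj \<phi>s)
  from Disj.IH[of _ f g] Disj.prems show ?case by force
next
  case (Conj \<phi>s)
  from Conj.IH[of _ f g] Conj.prems show ?case by force
qed simp_all

section \<open>Free variables and composition of renamings without capture\<close>

lemma image_fix_on:
  assumes "\<forall>x\<in>A - X. f x \<notin> X"
  shows "fix_on X f ` A - X = f ` (A - X)"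
proof (intro equalityI subsetI)
  fix y assume "y \<in> f ` (A - X)"
  then obtain x where "x \<in> A" "x \<notin> X" "y = f x" by auto
  then show "y \<in> fix_on X f ` A - X"
    using assms by (auto simp: fix_on_def image_iff intro!: bexI[of _ x])
qed (auto simp: fix_on_def split: if_splits)

text \<open>A captured variable would disappear from the free variables of the result. Under a
  quantifier, the variables in \<open>X\<close> are fixed and then removed, and by
  \<open>image_fix_on\<close> the others survive.\<close>

lemma fv_rename: "free_for f \<phi> \<Longrightarrow> fv (rename f \<phi>) = f ` fv \<phi>"
proof (induction \<phi> arbitrary: f)
  case (Exists X \<phi>)
  then show ?case by (simp add: image_fix_on)
next
  case (Forall X \<phi>)
  then show ?case by (simp add: image_fix_on)
qed (auto simp: tvars_rename_trm image_Un image_UN)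

text \<open>The two functions differ at a variable that \<open>f\<close> sends into
  \<open>X\<close>: there \<open>fix_on X g\<close> stops, while \<open>g \<circ> f\<close>
  continues with \<open>g\<close>. The equation is thus relative to the set \<open>A\<close>, which
  becomes the free variables of a formula through the congruence lemmas.\<close>

lemma fix_on_comp:
  assumes "\<forall>x\<in>A - X. f x \<notin> X" "x \<in> A"
  shows "(fix_on X g \<circ> fix_on X f) x = fix_on X (g \<circ> f) x"
  using assms by (auto simp: fix_on_def)

lemma rename_rename: "free_for f \<phi> \<Longrightarrow> rename g (rename f \<phi>) = rename (g \<circ> f) \<phi>"
proof (induction \<phi> arbitrary: f g)
  case (Exists X \<phi>)
  have "rename (fix_on X g) (rename (fix_on X f) \<phi>) = rename (fix_on X g \<circ> fix_on X f) \<phi>"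
    by (rule Exists.IH) (use Exists.prems in simp)
  also have "\<dots> = rename (fix_on X (g \<circ> f)) \<phi>"
    using Exists.prems by (intro rename_cong fix_on_comp) auto
  finally show ?case by (simp add: comp_def)
next
  case (Forall X \<phi>)
  have "rename (fix_on X g) (rename (fix_on X f) \<phi>) = rename (fix_on X g \<circ> fix_on X f) \<phi>"
    by (rule Forall.IH) (use Forall.prems in simp)
  also have "\<dots> = rename (fix_on X (g \<circ> f)) \<phi>"
    using Forall.prems by (intro rename_cong fix_on_comp) auto
  finally show ?case by (simp add: comp_def)
qed (auto simp: rename_trm_comp)

lemma free_for_rename: "free_for f \<phi> \<Longrightarrow> free_for g (rename f \<phi>) \<longleftrightarrow> free_for (g \<circ> f) \<phi>"
proof (induction \<phi> arbitrary: f g)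
  case (Exists X \<phi>)
  have "free_for (fix_on X g) (rename (fix_on X f) \<phi>) = free_for (fix_on X g \<circ> fix_on X f) \<phi>"
    by (rule Exists.IH) (use Exists.prems in simp)
  also have "\<dots> = free_for (fix_on X (g \<circ> f)) \<phi>"
    using Exists.prems by (intro free_for_cong fix_on_comp) auto
  finally show ?case using Exists.prems by (simp add: fv_rename image_fix_on comp_def)
next
  case (Forall X \<phi>)
  have "free_for (fix_on X g) (rename (fix_on X f) \<phi>) = free_for (fix_on X g \<circ> fix_on X f) \<phi>"
    by (rule Forall.IH) (use Forall.prems in simp)
  also have "\<dots> = free_for (fix_on X (g \<circ> f)) \<phi>"
    using Forall.prems by (intro free_for_cong fix_on_comp) auto
  finally show ?case using Forall.prems by (simp add: fv_rename image_fix_on comp_def)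
qed auto

text \<open>Below a quantifier over \<open>X\<close>, a renaming \<open>f\<close> acts as \<open>fix_on X f\<close>, which need not be a
  permutation even if \<open>f\<close> is one. It stays injective on the free variables as long as nothing is
  captured, and on a single formula such a renaming agrees with a permutation.\<close>

definition admissible :: "'v set \<Rightarrow> ('v \<Rightarrow> 'v) \<Rightarrow> ('f, 'p, 'v) fm \<Rightarrow> bool" where
  "admissible V f \<phi> \<longleftrightarrow> inj_on f (fv \<phi>) \<and> f ` fv \<phi> \<subseteq> V \<and> free_for f \<phi>"

lemma admissible_cong:
  assumes "\<And>x. x \<in> fv \<phi> \<Longrightarrow> f x = g x"
  shows "admissible V f \<phi> \<longleftrightarrow> admissible V g \<phi>"
proof -
  have "inj_on f (fv \<phi>) = inj_on g (fv \<phi>)"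
    by (rule inj_on_cong) (rule assms)
  moreover have "f ` fv \<phi> = g ` fv \<phi>"
    using assms by (rule image_cong[OF refl])
  moreover have "free_for f \<phi> = free_for g \<phi>"
    using assms by (rule free_for_cong)
  ultimately show ?thesis by (simp add: admissible_def)
qed

text \<open>With \<open>admissible_comp\<close> as its converse, this moves admissibility between a
  composite and its second factor. It allows two renamings that commute on a formula to be applied
  in the other order.\<close>

lemma admissible_rename:
  assumes "free_for f \<phi>" "admissible V (g \<circ> f) \<phi>"
  shows "admissible V g (rename f \<phi>)"
  using assms unfolding admissible_def
  by (auto simp: fv_rename free_for_rename inj_on_imageI)

lemma admissible_comp:
  assumes "admissible V f \<phi>" "admissible V g (rename f \<phi>)"
  shows "admissible V (g \<circ> f) \<phi>"
  using assms unfolding admissible_def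
  by (auto simp: fv_rename free_for_rename intro: comp_inj_on)

text \<open>The only new collision could be between a fixed variable in \<open>X\<close> and a moved
  one outside, and that would be a capture.\<close>

lemma inj_on_fix_on:
  assumes "\<forall>x\<in>A - X. f x \<notin> X" "inj_on f (A - X)"
  shows "inj_on (fix_on X f) A"
  using assms by (auto simp: inj_on_def fix_on_def split: if_splits)

lemma admissible_connectives:
  "admissible V f (Or \<phi> \<psi>) \<Longrightarrow> admissible V f \<phi> \<and> admissible V f \<psi>"
  "admissible V f (And \<phi> \<psi>) \<Longrightarrow> admissible V f \<phi> \<and> admissible V f \<psi>"
  "admissible V f (Disj \<phi>s) \<Longrightarrow> \<chi> \<in> set \<phi>s \<Longrightarrow> admissible V f \<chi>"
  "admissible V f (Conj \<phi>s) \<Longrightarrow> \<chi> \<in> set \<phi>s \<Longrightarrow> admissible V f \<chi>"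
  by (auto simp: admissible_def inj_on_def image_subset_iff)

text \<open>The variables of \<open>X\<close> may become free in the body, where they are mapped to
  themselves; their images lie in \<open>V\<close> because \<open>X\<close> does.\<close>

lemma admissible_quantifiers:
  assumes "X \<subseteq> V"
  shows "admissible V f (Exists X \<phi>) \<Longrightarrow> admissible V (fix_on X f) \<phi>"
    and "admissible V f (Forall X \<phi>) \<Longrightarrow> admissible V (fix_on X f) \<phi>"
  using assms unfolding admissible_def
  by (auto intro: inj_on_fix_on) (auto simp: fix_on_def)

lemma permutation_extends_injection:
  assumes "finite A" "inj_on f A"
  obtains \<sigma> where "\<sigma> permutes (A \<union> f ` A)" "\<And>x. x \<in> A \<Longrightarrow> \<sigma> x = f x"
proof -
  let ?B = "f ` A"
  have "card (?B - A) = card (A - ?B)"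
    using assms card_image[of f A] card_Diff_subset_Int[of ?B A] card_Diff_subset_Int[of A ?B]
    by (simp add: Int_commute)
  then obtain h where h: "bij_betw h (?B - A) (A - ?B)"
    using assms finite_same_card_bij[of "?B - A" "A - ?B"] by auto
  define \<sigma> where "\<sigma> x = (if x \<in> A then f x else if x \<in> ?B then h x else x)" for x
  have "bij_betw \<sigma> A ?B"
    using bij_betw_cong[of A \<sigma> f ?B] assms(2) by (simp add: \<sigma>_def bij_betw_def)
  moreover have "bij_betw \<sigma> (?B - A) (A - ?B)"
    using bij_betw_cong[of "?B - A" \<sigma> h "A - ?B"] h by (simp add: \<sigma>_def)
  ultimately have "bij_betw \<sigma> (A \<union> (?B - A)) (?B \<union> (A - ?B))"
    by (intro bij_betw_combine) auto
  then have "\<sigma> permutes (A \<union> ?B)"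
    by (intro bij_imp_permutes) (auto simp: \<sigma>_def Un_commute)
  then show thesis
    by (rule that) (simp add: \<sigma>_def)
qed

section \<open>Subsumption is a preorder invariant under renaming\<close>

lemma fv_formulas: "bounded_language S V L \<Longrightarrow> \<phi> \<in> formulas L \<Longrightarrow> fv \<phi> \<subseteq> V"
proof (induction L arbitrary: \<phi>)
  case (LBase A)
  then show ?case by (auto simp: base_set_def)
qed fastforce+

lemma admissible_permutes:
  assumes "bounded_language S V L" "\<phi> \<in> formulas L" "renamable X L" "X \<subseteq> V" "\<pi> permutes X"
  shows "admissible V \<pi> \<phi>"
  unfolding admissible_def
proof (intro conjI)
  show "inj_on \<pi> (fv \<phi>)"
    using assms(5) permutes_inj inj_on_subset by blast
  show "\<pi> ` fv \<phi> \<subseteq> V"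
    using fv_formulas[OF assms(1,2)] assms(4,5) permutes_in_image permutes_not_in
    by (smt (verit) image_subset_iff subsetD)
  show "free_for \<pi> \<phi>"
    using assms by (auto simp: renamable_def)
qed

text \<open>The induction needs arbitrary admissible renamings, since the body of a quantified
  formula is renamed by \<open>fix_on X f\<close>. Only at the base is the renaming replaced by a
  permutation that agrees with it on the formula.\<close>

lemma rename_in_formulas:
  "bounded_language S V L \<Longrightarrow> \<phi> \<in> formulas L \<Longrightarrow> admissible V f \<phi> \<Longrightarrow> rename f \<phi> \<in> formulas L"
proof (induction L arbitrary: f \<phi>)
  case (LBase A)
  show ?case
  proof (cases "\<phi> = Bot")
    case False
    then have \<phi>: "\<phi> \<in> A" "fv \<phi> \<subseteq> V" "f ` fv \<phi> \<subseteq> V" "inj_on f (fv \<phi>)"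
      using LBase by (auto simp: admissible_def base_set_def)
    obtain \<sigma> where \<sigma>: "\<sigma> permutes (fv \<phi> \<union> f ` fv \<phi>)" "\<And>x. x \<in> fv \<phi> \<Longrightarrow> \<sigma> x = f x"
      using permutation_extends_injection[OF finite_fv \<phi>(4)] by blast
    \<comment> \<open>The set permuted by \<open>\<sigma>\<close> is finite and lies in
      \<open>V\<close>, as \<open>base_set\<close> demands.\<close>
    have "rename \<sigma> \<phi> \<in> A"
      using LBase.prems(1) \<phi> \<sigma>(1) finite_fv[of \<phi>] unfolding bounded_language.simps base_set_def
      by (metis Un_least finite_UnI finite_imageI)
    then show ?thesis
      using rename_cong[of \<phi> \<sigma> f] \<sigma>(2) by simp
  qed simp
next
  case (LOr L1 L2)
  then show ?case by (fastforce dest: admissible_connectives)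
next
  case (LAnd L1 L2)
  then show ?case by (fastforce dest: admissible_connectives)
next
  case (LDisj k L)
  then show ?case by (fastforce dest: admissible_connectives)
next
  case (LConj L)
  then show ?case by (fastforce dest: admissible_connectives)
next
  case (LExists X L)
  then show ?case by (auto dest: admissible_quantifiers(1)[rotated])
next
  case (LForall X L)
  then show ?case by (auto dest: admissible_quantifiers(2)[rotated])
next
  case (LExFa X L)
  then show ?case
    by (auto dest: admissible_quantifiers(1)[rotated] admissible_quantifiers(2)[rotated])
qed

lemma rename_permutes_in_formulas:
  assumes "bounded_language S V L" "\<phi> \<in> formulas L" "renamable X L" "X \<subseteq> V" "\<pi> permutes X"
  shows "rename \<pi> \<phi> \<in> formulas L"
  using rename_in_formulas admissible_permutes assms by metis

text \<open>The relation on bodies shared by the three quantifier languages, so that invariance,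
  transitivity and canonicalization under a quantifier are each treated once.\<close>

definition qsubsumes :: "('f, 'p, 'v) lang \<Rightarrow> 'v set \<Rightarrow> ('f, 'p, 'v) fm \<Rightarrow> ('f, 'p, 'v) fm \<Rightarrow> bool" where
  "qsubsumes L X \<phi> \<psi> \<longleftrightarrow> (\<exists>\<pi>. \<pi> permutes X \<and> subsumes L \<phi> (rename \<pi> \<psi>))"

lemma subsumes_quantifiers [simp]:
  "subsumes (LExists X L) (Exists X \<phi>) (Exists X \<psi>) \<longleftrightarrow> qsubsumes L X \<phi> \<psi>"
  "subsumes (LForall X L) (Forall X \<phi>) (Forall X \<psi>) \<longleftrightarrow> qsubsumes L X \<phi> \<psi>"
  "subsumes (LExFa X L) (Exists X \<phi>) (Exists X \<psi>) \<longleftrightarrow> qsubsumes L X \<phi> \<psi>"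
  "subsumes (LExFa X L) (Forall X \<phi>) (Forall X \<psi>) \<longleftrightarrow> qsubsumes L X \<phi> \<psi>"
  "subsumes (LExFa X L) (Forall X \<phi>) (Exists X \<psi>) \<longleftrightarrow> qsubsumes L X \<phi> \<psi>"
  "\<not> subsumes (LExFa X L) (Exists X \<phi>) (Forall X \<psi>)"
  by (auto simp: qsubsumes_def)

text \<open>The witnessing permutation stays the same, because on the free variables of
  \<open>\<psi>\<close> it commutes with \<open>fix_on X f\<close>. The assumption
  \<open>invariant\<close> is the induction hypothesis of \<open>subsumes_rename\<close>.\<close>

lemma qsubsumes_rename:
  assumes bounded: "bounded_language S V L" "renamable X L" "X \<subseteq> V"
    and invariant: "\<And>f \<phi> \<psi>. \<lbrakk>\<phi> \<in> formulas L; \<psi> \<in> formulas L; admissible V f \<phi>; admissible V f \<psi>;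
      subsumes L \<phi> \<psi>\<rbrakk> \<Longrightarrow> subsumes L (rename f \<phi>) (rename f \<psi>)"
    and \<phi>: "\<phi> \<in> formulas L" "admissible V (fix_on X f) \<phi>"
    and \<psi>: "\<psi> \<in> formulas L" "admissible V (fix_on X f) \<psi>" "\<forall>x\<in>fv \<psi> - X. f x \<notin> X"
    and sub: "qsubsumes L X \<phi> \<psi>"
  shows "qsubsumes L X (rename (fix_on X f) \<phi>) (rename (fix_on X f) \<psi>)"
proof -
  let ?f = "fix_on X f"
  obtain \<pi> where \<pi>: "\<pi> permutes X" "subsumes L \<phi> (rename \<pi> \<psi>)"
    using sub by (auto simp: qsubsumes_def)
  \<comment> \<open>Without capture, \<open>f\<close> maps the free variables outside \<open>X\<close> outside \<open>X\<close>, where \<open>\<pi>\<close> is the identity.\<close>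
  have commute: "(?f \<circ> \<pi>) x = (\<pi> \<circ> ?f) x" if "x \<in> fv \<psi>" for x
    using that \<psi>(3) \<pi>(1) permutes_in_image[OF \<pi>(1)] permutes_not_in[OF \<pi>(1)]
    by (auto simp: fix_on_def)
  \<comment> \<open>Admissibility of \<open>?f\<close> on \<open>rename \<pi> \<psi>\<close> is
    reached by a detour: rename by \<open>?f\<close> first, where \<open>\<pi>\<close> is known to
    be admissible, and then exchange the two.\<close>
  have "admissible V \<pi> (rename ?f \<psi>)"
    using admissible_permutes rename_in_formulas bounded \<psi> \<pi>(1) by metis
  then have "admissible V (?f \<circ> \<pi>) \<psi>"
    using admissible_comp[OF \<psi>(2)] admissible_cong[of \<psi> "?f \<circ> \<pi>" "\<pi> \<circ> ?f", OF commute] by blast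
  moreover have free: "free_for \<pi> \<psi>"
    using bounded(2) \<psi>(1) \<pi>(1) by (auto simp: renamable_def)
  ultimately have "admissible V ?f (rename \<pi> \<psi>)"
    by (intro admissible_rename)
  moreover have "rename \<pi> \<psi> \<in> formulas L"
    using rename_permutes_in_formulas bounded \<psi>(1) \<pi>(1) by metis
  ultimately have "subsumes L (rename ?f \<phi>) (rename ?f (rename \<pi> \<psi>))"
    using invariant \<phi> \<pi>(2) by blast
  also have "rename ?f (rename \<pi> \<psi>) = rename \<pi> (rename ?f \<psi>)"
    using rename_rename free \<psi>(2) rename_cong[of \<psi> "?f \<circ> \<pi>" "\<pi> \<circ> ?f", OF commute] by (metis admissible_def)
  finally show ?thesis
    using \<pi>(1) by (auto simp: qsubsumes_def)
qed

text \<open>Needed to apply the permutation of one subsumption to another: in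
  \<open>qsubsumes_trans\<close> to compose them, in \<open>least_renaming\<close> to undo a
  permutation by its inverse.\<close>

lemma subsumes_rename:
  "\<lbrakk>bounded_language S V L; \<phi> \<in> formulas L; \<psi> \<in> formulas L; admissible V f \<phi>; admissible V f \<psi>;
    subsumes L \<phi> \<psi>\<rbrakk> \<Longrightarrow> subsumes L (rename f \<phi>) (rename f \<psi>)"
proof (induction L arbitrary: f \<phi> \<psi>)
  case (LBase A)
  then show ?case by auto
next
  case (LOr L1 L2)
  then show ?case by (auto dest!: admissible_connectives(1))
next
  case (LAnd L1 L2)
  then show ?case by (auto dest!: admissible_connectives(2))
next
  case (LDisj k L)
  then obtain \<phi>s \<psi>s m where *: "\<phi> = Disj \<phi>s" "\<psi> = Disj \<psi>s" "set \<phi>s \<subseteq> formulas L"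
      "set \<psi>s \<subseteq> formulas L" "inj_on m {..<length \<phi>s}" "m ` {..<length \<phi>s} \<subseteq> {..<length \<psi>s}"
      "\<forall>i<length \<phi>s. subsumes L (\<phi>s ! i) (\<psi>s ! m i)"
    by auto
  have "subsumes L (rename f (\<phi>s ! i)) (rename f (\<psi>s ! m i))" if i: "i < length \<phi>s" for i
  proof -
    have "\<phi>s ! i \<in> set \<phi>s" "\<psi>s ! m i \<in> set \<psi>s"
      using i *(6) by auto
    then show ?thesis
      using LDisj.prems * i by (intro LDisj.IH) (auto intro: admissible_connectives(3))
  qed
  then show ?case
    using * by (auto intro!: exI[of _ m])
next
  case (LConj L)
  then obtain \<phi>s \<psi>s m where *: "\<phi> = Conj \<phi>s" "\<psi> = Conj \<psi>s" "set \<phi>s \<subseteq> formulas L"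
      "set \<psi>s \<subseteq> formulas L" "m ` {..<length \<psi>s} \<subseteq> {..<length \<phi>s}"
      "\<forall>i<length \<psi>s. subsumes L (\<phi>s ! m i) (\<psi>s ! i)"
    by auto
  have "subsumes L (rename f (\<phi>s ! m i)) (rename f (\<psi>s ! i))" if i: "i < length \<psi>s" for i
  proof -
    have "\<psi>s ! i \<in> set \<psi>s" "\<phi>s ! m i \<in> set \<phi>s"
      using i *(5) by auto
    then show ?thesis
      using LConj.prems * i by (intro LConj.IH) (auto intro: admissible_connectives(4))
  qed
  then show ?case
    using * by (auto intro!: exI[of _ m])
next
  case (LExists X L)
  then obtain \<phi>' \<psi>' where *: "\<phi> = Exists X \<phi>'" "\<psi> = Exists X \<psi>'" "\<phi>' \<in> formulas L" "\<psi>' \<in> formulas L"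
    by auto
  have "qsubsumes L X (rename (fix_on X f) \<phi>') (rename (fix_on X f) \<psi>')"
  proof (rule qsubsumes_rename[of S V])
    show "\<forall>x\<in>fv \<psi>' - X. f x \<notin> X"
      using LExists.prems(5) * by (simp add: admissible_def)
    show "admissible V (fix_on X f) \<phi>'" "admissible V (fix_on X f) \<psi>'"
      using LExists.prems * by (auto intro: admissible_quantifiers)
    show "qsubsumes L X \<phi>' \<psi>'"
      using LExists.prems(6) * by (simp del: subsumes.simps)
  qed (use LExists * in auto)
  then show ?case using * by (simp del: subsumes.simps)
next
  case (LForall X L)
  then obtain \<phi>' \<psi>' where *: "\<phi> = Forall X \<phi>'" "\<psi> = Forall X \<psi>'" "\<phi>' \<in> formulas L" "\<psi>' \<in> formulas L"
    by auto
  have "qsubsumes L X (rename (fix_on X f) \<phi>') (rename (fix_on X f) \<psi>')"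
  proof (rule qsubsumes_rename[of S V])
    show "\<forall>x\<in>fv \<psi>' - X. f x \<notin> X"
      using LForall.prems(5) * by (simp add: admissible_def)
    show "admissible V (fix_on X f) \<phi>'" "admissible V (fix_on X f) \<psi>'"
      using LForall.prems * by (auto intro: admissible_quantifiers)
    show "qsubsumes L X \<phi>' \<psi>'"
      using LForall.prems(6) * by (simp del: subsumes.simps)
  qed (use LForall * in auto)
  then show ?case using * by (simp del: subsumes.simps)
next
  case (LExFa X L)
  have fa_ex: "qsubsumes L X (rename (fix_on X f) \<phi>') (rename (fix_on X f) \<psi>')"
    if "\<phi>' \<in> formulas L" "\<psi>' \<in> formulas L" "\<phi> \<in> {Exists X \<phi>', Forall X \<phi>'}"
      "\<psi> \<in> {Exists X \<psi>', Forall X \<psi>'}" "qsubsumes L X \<phi>' \<psi>'" for \<phi>' \<psi>'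
  proof (rule qsubsumes_rename[of S V])
    show "\<forall>x\<in>fv \<psi>' - X. f x \<notin> X"
      using LExFa.prems(5) that by (auto simp: admissible_def)
    show "admissible V (fix_on X f) \<phi>'" "admissible V (fix_on X f) \<psi>'"
      using LExFa.prems that by (auto intro: admissible_quantifiers)
  qed (use LExFa that in auto)
  show ?case
    using LExFa.prems(2,3,6) by (auto simp del: subsumes.simps intro!: fa_ex)
qed

section \<open>Reflexivity and transitivity of subsumption\<close>

lemma subsumes_refl: "\<phi> \<in> formulas L \<Longrightarrow> subsumes L \<phi> \<phi>"
proof (induction L arbitrary: \<phi>)
  case (LDisj k L)
  then obtain \<phi>s where "\<phi> = Disj \<phi>s" "set \<phi>s \<subseteq> formulas L" by auto
  then show ?case using LDisj.IH by (auto intro!: exI[of _ "\<lambda>i. i"] dest: nth_mem)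
next
  case (LConj L)
  then obtain \<phi>s where "\<phi> = Conj \<phi>s" "set \<phi>s \<subseteq> formulas L" by auto
  then show ?case using LConj.IH by (auto intro!: exI[of _ "\<lambda>i. i"] dest: nth_mem)
next
  case (LExists X L)
  then show ?case by (auto intro!: exI[of _ "\<lambda>x. x"] simp: rename_id permutes_id[unfolded id_def])
next
  case (LForall X L)
  then show ?case by (auto intro!: exI[of _ "\<lambda>x. x"] simp: rename_id permutes_id[unfolded id_def])
next
  case (LExFa X L)
  then show ?case by (auto intro!: exI[of _ "\<lambda>x. x"] simp: rename_id permutes_id[unfolded id_def])
qed auto

text \<open>Renaming the second subsumption by \<open>\<pi>\<close> makes its left side equal to the
  right side of the first. The composite is then witnessed by
  \<open>\<pi> \<circ> \<rho>\<close>.\<close>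

lemma qsubsumes_trans:
  assumes bounded: "bounded_language S V L" "renamable X L" "X \<subseteq> V"
    and trans: "\<And>\<phi> \<psi> \<chi>. \<lbrakk>\<phi> \<in> formulas L; \<psi> \<in> formulas L; \<chi> \<in> formulas L;
      subsumes L \<phi> \<psi>; subsumes L \<psi> \<chi>\<rbrakk> \<Longrightarrow> subsumes L \<phi> \<chi>"
    and in_L: "\<phi> \<in> formulas L" "\<psi> \<in> formulas L" "\<chi> \<in> formulas L"
    and sub: "qsubsumes L X \<phi> \<psi>" "qsubsumes L X \<psi> \<chi>"
  shows "qsubsumes L X \<phi> \<chi>"
proof -
  obtain \<pi> \<rho> where \<pi>: "\<pi> permutes X" "subsumes L \<phi> (rename \<pi> \<psi>)"
    and \<rho>: "\<rho> permutes X" "subsumes L \<psi> (rename \<rho> \<chi>)"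
    using sub by (auto simp: qsubsumes_def)
  note closed = rename_permutes_in_formulas[OF bounded(1) _ bounded(2,3)]
  note admissible = admissible_permutes[OF bounded(1) _ bounded(2,3)]
  have "subsumes L (rename \<pi> \<psi>) (rename \<pi> (rename \<rho> \<chi>))"
    using subsumes_rename[OF bounded(1)] closed admissible in_L \<pi>(1) \<rho> by metis
  moreover have "free_for \<rho> \<chi>"
    using bounded(2) in_L(3) \<rho>(1) by (auto simp: renamable_def)
  then have "rename \<pi> (rename \<rho> \<chi>) = rename (\<pi> \<circ> \<rho>) \<chi>"
    by (rule rename_rename)
  moreover have "\<pi> \<circ> \<rho> permutes X"
    using \<rho>(1) \<pi>(1) by (rule permutes_compose)
  ultimately show ?thesis
    using trans closed in_L \<pi> unfolding qsubsumes_def by metis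
qed

lemma subsumes_trans:
  "\<lbrakk>bounded_language S V L; \<phi> \<in> formulas L; \<psi> \<in> formulas L; \<chi> \<in> formulas L;
    subsumes L \<phi> \<psi>; subsumes L \<psi> \<chi>\<rbrakk> \<Longrightarrow> subsumes L \<phi> \<chi>"
proof (induction L arbitrary: \<phi> \<psi> \<chi>)
  case (LBase A)
  then show ?case by auto
next
  case (LOr L1 L2)
  from LOr.prems show ?case by (auto intro: LOr.IH)
next
  case (LAnd L1 L2)
  from LAnd.prems show ?case by (auto intro: LAnd.IH)
next
  case (LDisj k L)
  from LDisj.prems(2-5) obtain \<phi>s \<psi>s m where 1: "\<phi> = Disj \<phi>s" "\<psi> = Disj \<psi>s"
      "set \<phi>s \<subseteq> formulas L" "set \<psi>s \<subseteq> formulas L" "inj_on m {..<length \<phi>s}"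
      "m ` {..<length \<phi>s} \<subseteq> {..<length \<psi>s}" "\<And>i. i < length \<phi>s \<Longrightarrow> subsumes L (\<phi>s ! i) (\<psi>s ! m i)"
    by auto
  from LDisj.prems(4,6) 1(2) obtain \<chi>s n where 2: "\<chi> = Disj \<chi>s"
      "set \<chi>s \<subseteq> formulas L" "inj_on n {..<length \<psi>s}"
      "n ` {..<length \<psi>s} \<subseteq> {..<length \<chi>s}" "\<And>i. i < length \<psi>s \<Longrightarrow> subsumes L (\<psi>s ! i) (\<chi>s ! n i)"
    by auto
  have "subsumes L (\<phi>s ! i) (\<chi>s ! n (m i))" if "i < length \<phi>s" for i
  proof -
    have "m i < length \<psi>s" "n (m i) < length \<chi>s"
      using that 1(6) 2(4) by auto
    then show ?thesis
      using that 1 2 LDisj.prems(1) LDisj.IH[of "\<phi>s ! i" "\<psi>s ! m i"]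
      by (meson bounded_language.simps(4) nth_mem subsetD)
  qed
  moreover have "inj_on (\<lambda>i. n (m i)) {..<length \<phi>s}"
    using comp_inj_on[OF 1(5) inj_on_subset[OF 2(3) 1(6)]] by (simp add: comp_def)
  moreover have "(\<lambda>i. n (m i)) ` {..<length \<phi>s} \<subseteq> {..<length \<chi>s}"
    using 1(6) 2(4) by (auto simp: image_subset_iff)
  ultimately show ?case
    unfolding 1(1) 2(1) subsumes.simps
    by - (rule exI[of _ \<phi>s], rule exI[of _ \<chi>s], rule exI[of _ "\<lambda>i. n (m i)"], simp)
next
  case (LConj L)
  from LConj.prems(2-5) obtain \<phi>s \<psi>s m where 1: "\<phi> = Conj \<phi>s" "\<psi> = Conj \<psi>s"
      "set \<phi>s \<subseteq> formulas L" "set \<psi>s \<subseteq> formulas L"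
      "m ` {..<length \<psi>s} \<subseteq> {..<length \<phi>s}" "\<And>i. i < length \<psi>s \<Longrightarrow> subsumes L (\<phi>s ! m i) (\<psi>s ! i)"
    by auto
  from LConj.prems(4,6) 1(2) obtain \<chi>s n where 2: "\<chi> = Conj \<chi>s" "set \<chi>s \<subseteq> formulas L"
      "n ` {..<length \<chi>s} \<subseteq> {..<length \<psi>s}" "\<And>i. i < length \<chi>s \<Longrightarrow> subsumes L (\<psi>s ! n i) (\<chi>s ! i)"
    by auto
  \<comment> \<open>Index maps of conjunctions run from right to left, so they compose in the order
    opposite to that for disjunctions.\<close>
  have "subsumes L (\<phi>s ! m (n i)) (\<chi>s ! i)" if "i < length \<chi>s" for i
  proof -
    have "n i < length \<psi>s" "m (n i) < length \<phi>s"
      using that 1(5) 2(3) by auto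
    then show ?thesis
      using that 1 2 LConj.prems(1) LConj.IH[of "\<phi>s ! m (n i)" "\<psi>s ! n i"]
      by (meson bounded_language.simps(5) nth_mem subsetD)
  qed
  moreover have "(\<lambda>i. m (n i)) ` {..<length \<chi>s} \<subseteq> {..<length \<phi>s}"
    using 1(5) 2(3) by (auto simp: image_subset_iff)
  ultimately show ?case
    unfolding 1(1) 2(1) subsumes.simps
    by - (rule exI[of _ \<phi>s], rule exI[of _ \<chi>s], rule exI[of _ "\<lambda>i. m (n i)"], simp)
next
  case (LExists X L)
  then have X: "bounded_language S V L" "renamable X L" "X \<subseteq> V"
    by simp_all
  note trans = qsubsumes_trans[OF X LExists.IH[OF X(1)]]
  show ?case
    using LExists.prems(2-) by (auto simp del: subsumes.simps intro: trans)
next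
  case (LForall X L)
  then have X: "bounded_language S V L" "renamable X L" "X \<subseteq> V"
    by simp_all
  note trans = qsubsumes_trans[OF X LForall.IH[OF X(1)]]
  show ?case
    using LForall.prems(2-) by (auto simp del: subsumes.simps intro: trans)
next
  case (LExFa X L)
  then have X: "bounded_language S V L" "renamable X L" "X \<subseteq> V"
    by simp_all
  note trans = qsubsumes_trans[OF X LExFa.IH[OF X(1)]]
  show ?case
    using LExFa.prems(2-) by (auto simp del: subsumes.simps intro: trans)
qed

section \<open>The order is linear\<close>

text \<open>The counterpart of \<open>linear_order_on\<close> for a predicate. It is relative to a
  set because \<open>leq ord L\<close> is an order only among the formulas of
  \<open>L\<close>.\<close>

definition linear_on :: "'a set \<Rightarrow> ('a \<Rightarrow> 'a \<Rightarrow> bool) \<Rightarrow> bool" where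
  "linear_on B le \<longleftrightarrow> reflp_on B le \<and> transp_on B le \<and> antisymp_on B le \<and> totalp_on B le"

lemma linear_onI:
  assumes "\<And>x. x \<in> B \<Longrightarrow> le x x"
    and "\<And>x y z. \<lbrakk>x \<in> B; y \<in> B; z \<in> B; le x y; le y z\<rbrakk> \<Longrightarrow> le x z"
    and "\<And>x y. \<lbrakk>x \<in> B; y \<in> B; le x y; le y x\<rbrakk> \<Longrightarrow> x = y"
    and "\<And>x y. \<lbrakk>x \<in> B; y \<in> B\<rbrakk> \<Longrightarrow> le x y \<or> le y x"
  shows "linear_on B le"
  unfolding linear_on_def
proof (intro conjI)
  show "reflp_on B le" by (rule reflp_onI) (rule assms(1))
  show "transp_on B le" by (rule transp_onI) (rule assms(2))
  show "antisymp_on B le" by (rule antisymp_onI) (rule assms(3))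
  show "totalp_on B le" by (rule totalp_onI) (rule assms(4))
qed

lemma linear_onD:
  assumes "linear_on B le"
  shows "x \<in> B \<Longrightarrow> le x x"
    and "\<lbrakk>x \<in> B; y \<in> B; z \<in> B; le x y; le y z\<rbrakk> \<Longrightarrow> le x z"
    and "\<lbrakk>x \<in> B; y \<in> B; le x y; le y x\<rbrakk> \<Longrightarrow> x = y"
    and "\<lbrakk>x \<in> B; y \<in> B\<rbrakk> \<Longrightarrow> le x y \<or> le y x"
proof -
  have le: "reflp_on B le" "transp_on B le" "antisymp_on B le" "totalp_on B le"
    using assms by (simp_all add: linear_on_def)
  show "x \<in> B \<Longrightarrow> le x x"
    using le(1) by (rule reflp_onD)
  show "\<lbrakk>x \<in> B; y \<in> B; z \<in> B; le x y; le y z\<rbrakk> \<Longrightarrow> le x z"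
    using le(2) by (rule transp_onD)
  show "\<lbrakk>x \<in> B; y \<in> B; le x y; le y x\<rbrakk> \<Longrightarrow> x = y"
    using le(3) by (rule antisymp_onD)
  show "\<lbrakk>x \<in> B; y \<in> B\<rbrakk> \<Longrightarrow> le x y \<or> le y x"
    using le(1,4) reflp_onD totalp_onD by metis
qed

lemma linear_on_subset: "linear_on B le \<Longrightarrow> A \<subseteq> B \<Longrightarrow> linear_on A le"
  unfolding linear_on_def
  by (elim conjE, intro conjI)
    (erule reflp_on_subset transp_on_subset antisymp_on_subset totalp_on_subset, assumption)+

text \<open>Used with a constructor as \<open>c\<close>: linearity on formulas is reduced to
  linearity on pairs, lists or bodies.\<close>

lemma linear_on_image:
  assumes "linear_on B le" "\<And>x y. x \<in> B \<Longrightarrow> y \<in> B \<Longrightarrow> le' (c x) (c y) \<longleftrightarrow> le x y"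
  shows "linear_on (c ` B) le'"
proof (rule linear_onI)
  note D = linear_onD[OF assms(1)]
  fix u assume "u \<in> c ` B"
  then obtain x where x: "x \<in> B" "u = c x" by blast
  then show "le' u u"
    using assms(2) D(1) by simp
  fix v assume "v \<in> c ` B"
  then obtain y where y: "y \<in> B" "v = c y" by blast
  show "le' u v \<or> le' v u"
    using x y assms(2) D(4)[of x y] by simp
  show "u = v" if "le' u v" "le' v u"
    using that x y assms(2) D(3)[of x y] by simp
  fix w assume "w \<in> c ` B"
  then obtain z where z: "z \<in> B" "w = c z" by blast
  show "le' u w" if "le' u v" "le' v w"
    using that x y z assms(2) D(2)[of x y z] by simp
qed

lemma linear_on_lex2:
  assumes "linear_on A le1" "linear_on B le2"
  shows "linear_on (A \<times> B) (\<lambda>p q. lex2 le1 le2 (fst p) (snd p) (fst q) (snd q))"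
proof (rule linear_onI)
  note D1 = linear_onD[OF assms(1)] and D2 = linear_onD[OF assms(2)]
  fix p
  assume p: "p \<in> A \<times> B"
  then show "lex2 le1 le2 (fst p) (snd p) (fst p) (snd p)"
    using D2(1) by (auto simp: lex2_def)
  fix q
  assume q: "q \<in> A \<times> B"
  from p q show "lex2 le1 le2 (fst p) (snd p) (fst q) (snd q) \<or>
      lex2 le1 le2 (fst q) (snd q) (fst p) (snd p)"
    using D1(4)[of "fst p" "fst q"] D2(4)[of "snd p" "snd q"] by (auto simp: lex2_def)
  assume pq: "lex2 le1 le2 (fst p) (snd p) (fst q) (snd q)"
  {
    assume "lex2 le1 le2 (fst q) (snd q) (fst p) (snd p)"
    with p q pq show "p = q"
      using D1(3)[of "fst p" "fst q"] D2(3)[of "snd p" "snd q"] by (auto simp: lex2_def prod_eq_iff)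
  }
  fix r
  assume "r \<in> A \<times> B" "lex2 le1 le2 (fst q) (snd q) (fst r) (snd r)"
  with p q pq show "lex2 le1 le2 (fst p) (snd p) (fst r) (snd r)"
    using D1(2)[of "fst p" "fst q" "fst r"] D1(3)[of "fst p" "fst q"] D2(2)[of "snd p" "snd q" "snd r"]
    by (auto simp: lex2_def)
qed

section \<open>Lexicographic order on lists\<close>

lemma first_diff_less_simps [simp]:
  "\<not> first_diff_less le [] ys"
  "\<not> first_diff_less le xs []"
  "first_diff_less le (x # xs) (y # ys) \<longleftrightarrow> x \<noteq> y \<and> le x y \<or> x = y \<and> first_diff_less le xs ys"
proof -
  show "first_diff_less le (x # xs) (y # ys) \<longleftrightarrow> x \<noteq> y \<and> le x y \<or> x = y \<and> first_diff_less le xs ys"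
    (is "?L \<longleftrightarrow> ?R")
  proof
    assume ?L
    then obtain i where "i < length (x # xs)" "i < length (y # ys)"
        "take i (x # xs) = take i (y # ys)" "(x # xs) ! i \<noteq> (y # ys) ! i" "le ((x # xs) ! i) ((y # ys) ! i)"
      by (auto simp: first_diff_less_def)
    then show ?R
      by (cases i) (auto simp: first_diff_less_def)
  next
    assume ?R
    then show ?L
    proof
      assume "x = y \<and> first_diff_less le xs ys"
      then obtain i where "x = y" "i < length xs" "i < length ys" "take i xs = take i ys"
          "xs ! i \<noteq> ys ! i" "le (xs ! i) (ys ! i)"
        by (auto simp: first_diff_less_def)
      then show ?L
        unfolding first_diff_less_def by (intro exI[of _ "Suc i"]) auto
    next
      assume "x \<noteq> y \<and> le x y"
      then show ?L
        unfolding first_diff_less_def by (intro exI[of _ 0]) simp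
    qed
  qed
qed (simp_all add: first_diff_less_def)

text \<open>One order that serves both sequence connectives. The order on disjunctions is
  \<open>lex_le\<close> on reversed lists; the order on conjunctions, where a longer list is
  smaller, is the converse of \<open>lex_le\<close> for the converse order on entries.\<close>

definition lex_le :: "('a \<Rightarrow> 'a \<Rightarrow> bool) \<Rightarrow> 'a list \<Rightarrow> 'a list \<Rightarrow> bool" where
  "lex_le le xs ys \<longleftrightarrow> prefix xs ys \<or> first_diff_less le xs ys"

lemma lex_le_simps [simp]:
  "lex_le le [] ys"
  "\<not> lex_le le (x # xs) []"
  "lex_le le (x # xs) (y # ys) \<longleftrightarrow> x \<noteq> y \<and> le x y \<or> x = y \<and> lex_le le xs ys"
  unfolding lex_le_def by simp_all blast

lemma linear_on_lex_le:
  assumes "linear_on B le"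
  shows "linear_on (lists B) (lex_le le)"
  unfolding lists_eq_set
proof (rule linear_onI)
  fix xs assume "xs \<in> {xs. set xs \<subseteq> B}"
  then show "lex_le le xs xs" by (induction xs) auto
next
  fix xs ys zs assume "xs \<in> {xs. set xs \<subseteq> B}" "ys \<in> {xs. set xs \<subseteq> B}" "zs \<in> {xs. set xs \<subseteq> B}" "lex_le le xs ys" "lex_le le ys zs"
  then show "lex_le le xs zs"
  proof (induction xs arbitrary: ys zs)
    case (Cons x xs)
    then obtain y ys' where ys: "ys = y # ys'" by (cases ys) auto
    with Cons obtain z zs' where zs: "zs = z # zs'" by (cases zs) auto
    \<comment> \<open>If \<open>x\<close> is strictly below \<open>y\<close> and \<open>y\<close> is
      below \<open>z\<close>, then \<open>x\<close> and \<open>z\<close> differ, for otherwise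
      antisymmetry would give \<open>x = y\<close>.\<close>
    show ?case
      using Cons.prems Cons.IH[of ys' zs'] ys zs linear_onD(2)[OF assms, of x y z]
        linear_onD(3)[OF assms, of x y] by auto
  qed simp
next
  fix xs ys assume "xs \<in> {xs. set xs \<subseteq> B}" "ys \<in> {xs. set xs \<subseteq> B}" "lex_le le xs ys" "lex_le le ys xs"
  then show "xs = ys"
  proof (induction xs arbitrary: ys)
    case Nil
    then show ?case by (cases ys) auto
  next
    case (Cons x xs)
    then obtain y ys' where "ys = y # ys'" by (cases ys) auto
    with Cons show ?case using linear_onD(3)[OF assms] by auto
  qed
next
  fix xs ys assume "xs \<in> {xs. set xs \<subseteq> B}" "ys \<in> {xs. set xs \<subseteq> B}"
  then show "lex_le le xs ys \<or> lex_le le ys xs"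
  proof (induction xs arbitrary: ys)
    case (Cons x xs)
    then show ?case
    proof (cases ys)
      case (Cons y ys')
      then show ?thesis using Cons.prems Cons.IH[of ys'] linear_onD(4)[OF assms, of x y] by auto
    qed simp
  qed simp
qed

lemma first_diff_less_converse:
  "first_diff_less le xs ys \<longleftrightarrow> first_diff_less (\<lambda>x y. le y x) ys xs"
  unfolding first_diff_less_def by (intro ex_cong1) (simp add: conj_left_commute eq_commute)

lemma linear_on_converse:
  assumes "linear_on B le"
  shows "linear_on B (\<lambda>x y. le y x)"
proof (rule linear_onI)
  note D = linear_onD[OF assms]
  fix x y assume xy: "x \<in> B" "y \<in> B"
  show "le x x"
    using xy(1) by (rule D(1))
  show "le y x \<or> le x y"
    using xy(2,1) by (rule D(4))
  show "x = y" if "le y x" "le x y"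
    using xy that(2,1) by (rule D(3))
  show "le z x" if "z \<in> B" "le y x" "le z y" for z
    using that(1) xy(2,1) that(3,2) by (rule D(2))
qed

lemma linear_on_leq:
  assumes ord: "\<And>A. base_set S V A \<Longrightarrow> is_base_order A (ord A)"
  shows "bounded_language S V L \<Longrightarrow> linear_on (formulas L) (leq ord L)"
proof (induction L)
  case (LBase A)
  then have "linear_order_on (formulas (LBase A)) (ord A)"
    using ord by (simp add: is_base_order_def)
  then have "refl_on (formulas (LBase A)) (ord A)" "trans (ord A)" "antisym (ord A)"
      "total_on (formulas (LBase A)) (ord A)"
    by (auto simp: order_on_defs)
  then show ?case
    unfolding leq.simps
    by (intro linear_onI) (metis refl_onD, metis transD, metis antisymD, metis refl_onD total_on_def)
next
  case (LOr L1 L2)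
  have "formulas (LOr L1 L2) = (\<lambda>p. Or (fst p) (snd p)) ` (formulas L1 \<times> formulas L2)"
    by force
  then show ?case
    using linear_on_image[OF linear_on_lex2, of "formulas L1" "leq ord L1" "formulas L2" "leq ord L2"
        "leq ord (LOr L1 L2)" "\<lambda>p. Or (fst p) (snd p)"] LOr by simp
next
  case (LAnd L1 L2)
  have "formulas (LAnd L1 L2) = (\<lambda>p. And (fst p) (snd p)) ` (formulas L1 \<times> formulas L2)"
    by force
  then show ?case
    using linear_on_image[OF linear_on_lex2, of "formulas L1" "leq ord L1" "formulas L2" "leq ord L2"
        "leq ord (LAnd L1 L2)" "\<lambda>p. And (fst p) (snd p)"] LAnd by simp
next
  case (LDisj k L)
  \<comment> \<open>Linearity is shown for disjunctions of every length and restricted afterwards.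
    Reversal turns the comparison from the end into one from the front.\<close>
  have "linear_on ((\<lambda>\<phi>s. Disj (rev \<phi>s)) ` lists (formulas L)) (leq ord (LDisj k L))"
    using LDisj by (intro linear_on_image[OF linear_on_lex_le]) (auto simp: lex_le_def suffix_to_prefix)
  moreover have "formulas (LDisj k L) \<subseteq> (\<lambda>\<phi>s. Disj (rev \<phi>s)) ` lists (formulas L)"
  proof
    fix \<phi> assume "\<phi> \<in> formulas (LDisj k L)"
    then obtain \<phi>s where "\<phi> = Disj \<phi>s" "set \<phi>s \<subseteq> formulas L" by auto
    then show "\<phi> \<in> (\<lambda>\<phi>s. Disj (rev \<phi>s)) ` lists (formulas L)"
      by (intro image_eqI[of _ _ "rev \<phi>s"]) auto
  qed
  ultimately show ?case by (rule linear_on_subset)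
next
  case (LConj L)
  \<comment> \<open>Reversing only outside would put extensions below their prefixes but also
    reverse the comparison at the first difference; reversing the entries as well restores the
    latter.\<close>
  have "linear_on (lists (formulas L)) (\<lambda>\<phi>s \<psi>s. lex_le (\<lambda>\<phi> \<psi>. leq ord L \<psi> \<phi>) \<psi>s \<phi>s)"
    using LConj by (simp add: linear_on_converse[OF linear_on_lex_le[OF linear_on_converse]])
  then have "linear_on (Conj ` lists (formulas L)) (leq ord (LConj L))"
    by (rule linear_on_image) (simp add: lex_le_def first_diff_less_converse[of "leq ord L"])
  then show ?case by (rule linear_on_subset) auto
next
  case (LExists X L)
  have "formulas (LExists X L) = Exists X ` formulas L" by auto
  then show ?case
    using linear_on_image[of "formulas L" "leq ord L" "leq ord (LExists X L)" "Exists X"] LExists by simp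
next
  case (LForall X L)
  have "formulas (LForall X L) = Forall X ` formulas L" by auto
  then show ?case
    using linear_on_image[of "formulas L" "leq ord L" "leq ord (LForall X L)" "Forall X"] LForall by simp
next
  case (LExFa X L)
  \<comment> \<open>The tag is \<open>True\<close> for the existential quantifier. As
    \<open>False\<close> is below \<open>True\<close>, comparing tags before bodies puts every
    universal formula below every existential one.\<close>
  let ?quant = "\<lambda>p. if fst p then Exists X (snd p) else Forall X (snd p)"
  have "formulas (LExFa X L) = ?quant ` (UNIV \<times> formulas L)"
    by (force split: if_splits)
  moreover have "linear_on UNIV ((\<le>) :: bool \<Rightarrow> bool \<Rightarrow> bool)"
    by (rule linear_onI) auto
  then have "linear_on (?quant ` (UNIV \<times> formulas L)) (leq ord (LExFa X L))"
    using LExFa by (intro linear_on_image[OF linear_on_lex2]) (auto simp: lex2_def)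
  ultimately show ?case by simp
qed

section \<open>Least elements and sorted lists: the definite descriptions denote\<close>

lemma least_in:
  assumes "linear_on C le" "finite B" "B \<noteq> {}" "B \<subseteq> C"
  shows "least le B \<in> B \<and> (\<forall>y\<in>B. le (least le B) y)"
proof -
  have "\<exists>x\<in>B. \<forall>y\<in>B. le x y"
    using assms(2-4)
  proof (induction rule: finite_ne_induct)
    case (singleton x)
    then show ?case using linear_onD(1)[OF assms(1)] by simp
  next
    case (insert a B)
    then obtain x where "x \<in> B" "\<forall>y\<in>B. le x y" by auto
    with insert.prems show ?case
      using linear_onD(1,4)[OF assms(1)] linear_onD(2)[OF assms(1), of a x]
      by (smt (verit) insertE insert_subset subsetD insertI1 insertI2)
  qed
  then have "\<exists>!x. x \<in> B \<and> (\<forall>y\<in>B. le x y)"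
    using linear_onD(3)[OF assms(1)] assms(4) by (metis subsetD)
  then show ?thesis
    unfolding least_def by (rule theI')
qed

text \<open>Two different heads would each occur in the tail of the other list, hence lie below each
  other, against antisymmetry.\<close>

lemma sorted_wrt_unique:
  assumes "linear_on C le"
  shows "\<lbrakk>mset xs = mset ys; set xs \<subseteq> C; sorted_wrt le xs; sorted_wrt le ys\<rbrakk> \<Longrightarrow> xs = ys"
proof (induction xs arbitrary: ys)
  case (Cons x xs)
  then obtain y ys' where ys: "ys = y # ys'" by (cases ys) auto
  have sets: "set (x # xs) = set (y # ys')"
    using Cons.prems(1) ys mset_eq_setD by blast
  have "x = y"
  proof (rule ccontr)
    assume "x \<noteq> y"
    then have "le x y" "le y x" "y \<in> C" "x \<in> C"
      using Cons.prems ys sets by auto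
    then show False using linear_onD(3)[OF assms] \<open>x \<noteq> y\<close> by blast
  qed
  then show ?case using Cons ys by auto
qed simp

text \<open>Subsumption of sequences depends on their entries and not on the order of these, so the
  content of the sorted list is the fact that later proofs draw on.\<close>

lemma mset_ascending:
  assumes "linear_on C le" "set_mset M \<subseteq> C"
  shows "mset (ascending le M) = M"
proof -
  have "\<exists>xs. mset xs = M \<and> sorted_wrt le xs"
    using assms(2)
  proof (induction "size M" arbitrary: M)
    case (Suc n)
    \<comment> \<open>Selection sort: a least entry is put first and the rest is sorted by
      induction.\<close>
    let ?x = "least le (set_mset M)"
    have x: "?x \<in># M" "\<And>y. y \<in># M \<Longrightarrow> le ?x y"
      using least_in[OF assms(1), of "set_mset M"] Suc.hyps(2) Suc.prems by (cases "M = {#}"; simp)+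
    have "n = size (M - {#?x#})" "set_mset (M - {#?x#}) \<subseteq> C"
      using Suc.hyps(2) Suc.prems x(1) by (auto simp: size_Diff_singleton dest: in_diffD)
    then obtain xs where xs: "mset xs = M - {#?x#}" "sorted_wrt le xs"
      using Suc.hyps(1) by blast
    have "\<forall>y\<in>set xs. le ?x y"
      using x(2) xs(1) by (metis in_diffD set_mset_mset)
    then show ?case
      using x(1) xs by (intro exI[of _ "?x # xs"]) simp
  qed auto
  moreover have "xs = ys" if "mset xs = M \<and> sorted_wrt le xs" "mset ys = M \<and> sorted_wrt le ys" for xs ys
    using sorted_wrt_unique[OF assms(1), of xs ys] that assms(2) by (metis set_mset_mset)
  ultimately have "\<exists>!xs. mset xs = M \<and> sorted_wrt le xs"
    by blast
  then show ?thesis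
    unfolding ascending_def by (rule theI'[THEN conjunct1])
qed

section \<open>Canonical forms\<close>

text \<open>If \<open>y\<close> is not minimal, some \<open>z\<close> is below \<open>y\<close> but
  not above it. The induction continues with the elements below \<open>z\<close>, a smaller set
  because it misses \<open>y\<close>.\<close>

lemma minimal_below:
  assumes "finite B"
    and "\<And>x. x \<in> B \<Longrightarrow> le x x"
    and "\<And>x y z. \<lbrakk>x \<in> B; y \<in> B; z \<in> B; le x y; le y z\<rbrakk> \<Longrightarrow> le x z"
    and "y \<in> B"
  shows "\<exists>x\<in>minimal le B. le x y"
  using assms
proof (induction B arbitrary: y rule: finite_psubset_induct)
  case (psubset B)
  show ?case
  proof (cases "y \<in> minimal le B")
    case True
    then show ?thesis using psubset.prems(1)[OF psubset.prems(3)] by blast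
  next
    case False
    then obtain z where z: "z \<in> B" "le z y" "\<not> le y z"
      using psubset.prems(3) by (auto simp: minimal_def)
    define B' where "B' = {w \<in> B. le w z}"
    have B': "B' \<subset> B" "z \<in> B'"
      using z psubset.prems(1)[of z] psubset.prems(3) by (auto simp: B'_def)
    have "\<exists>x\<in>minimal le B'. le x z"
    proof (rule psubset.IH[OF B'(1) _ _ B'(2)])
      show "\<And>x. x \<in> B' \<Longrightarrow> le x x"
        using psubset.prems(1) by (simp add: B'_def)
      show "le x w" if "x \<in> B'" "y \<in> B'" "w \<in> B'" "le x y" "le y w" for x y w
        using that psubset.prems(2)[of x y w] by (simp add: B'_def)
    qed
    then obtain x where x: "x \<in> B" "\<forall>w\<in>B'. le w x \<longrightarrow> le x w" "le x z"
      by (auto simp: minimal_def B'_def)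
    \<comment> \<open>\<open>B'\<close> is downward closed in \<open>B\<close>, so an element
      minimal in \<open>B'\<close> is minimal in \<open>B\<close>.\<close>
    have "w \<in> B'" if "w \<in> B" "le w x" for w
      using that psubset.prems(2)[of w x z] x z(1) by (simp add: B'_def)
    then have "x \<in> minimal le B"
      using x by (auto simp: minimal_def)
    moreover have "le x y"
      using psubset.prems(2)[of x z y] psubset.prems(3) x(1,3) z(1,2) by blast
    ultimately show ?thesis by blast
  qed
qed

text \<open>The least body is the canonical form of \<open>rename \<pi> \<phi>\<close> for some
  \<open>\<pi>\<close>, so it is equivalent to that renaming, and the inverse of
  \<open>\<pi>\<close> leads back to \<open>\<phi>\<close>. That it is itself a canonical form of
  \<open>L\<close> keeps the number of canonical quantified formulas finite.\<close>

lemma least_renaming: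
  assumes "\<And>A. base_set S V A \<Longrightarrow> is_base_order A (ord A)"
    and bounded: "bounded_language S V L" "renamable X L" "finite X" "X \<subseteq> V"
    and canon: "\<And>\<phi>. \<phi> \<in> formulas L \<Longrightarrow> canon ord L \<phi> \<in> formulas L \<and>
      subsumes L \<phi> (canon ord L \<phi>) \<and> subsumes L (canon ord L \<phi>) \<phi>"
    and \<phi>: "\<phi> \<in> formulas L"
  defines "\<psi> \<equiv> least (leq ord L) {canon ord L (rename \<pi> \<phi>) |\<pi>. \<pi> permutes X}"
  shows "\<psi> \<in> canon ord L ` formulas L" "qsubsumes L X \<phi> \<psi>" "qsubsumes L X \<psi> \<phi>"
proof -
  note closed = rename_permutes_in_formulas[OF bounded(1) _ bounded(2,4)]
  note admissible = admissible_permutes[OF bounded(1) _ bounded(2,4)]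
  let ?B = "{canon ord L (rename \<pi> \<phi>) |\<pi>. \<pi> permutes X}"
  have "?B = (\<lambda>\<pi>. canon ord L (rename \<pi> \<phi>)) ` {\<pi>. \<pi> permutes X}"
    by auto
  then have "finite ?B"
    using finite_permutations[OF bounded(3)] by simp
  moreover have "?B \<noteq> {}"
    using permutes_id[of X] by blast
  moreover have "?B \<subseteq> formulas L"
    using closed[OF \<phi>] canon by blast
  ultimately have "\<psi> \<in> ?B"
    unfolding \<psi>_def using least_in[OF linear_on_leq[OF assms(1) bounded(1)]] by blast
  then obtain \<pi> where \<pi>: "\<pi> permutes X" and \<psi>_eq: "\<psi> = canon ord L (rename \<pi> \<phi>)"
    by blast
  have \<psi>: "\<psi> \<in> formulas L" "subsumes L (rename \<pi> \<phi>) \<psi>" "subsumes L \<psi> (rename \<pi> \<phi>)"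
    using canon[OF closed[OF \<phi> \<pi>]] by (simp_all add: \<psi>_eq)
  have inv: "inv \<pi> permutes X"
    using \<pi> by (rule permutes_inv)
  have "free_for \<pi> \<phi>"
    using bounded(2) \<phi> \<pi> by (auto simp: renamable_def)
  then have "rename (inv \<pi>) (rename \<pi> \<phi>) = rename (inv \<pi> \<circ> \<pi>) \<phi>"
    by (rule rename_rename)
  also have "\<dots> = \<phi>"
    using permutes_inv_o(2)[OF \<pi>] rename_id[of \<phi>] by (simp add: id_def)
  finally have "subsumes L \<phi> (rename (inv \<pi>) \<psi>)"
    using subsumes_rename[OF bounded(1) closed[OF \<phi> \<pi>] \<psi>(1) admissible[OF closed[OF \<phi> \<pi>] inv]
        admissible[OF \<psi>(1) inv] \<psi>(2)] by simp
  then show "qsubsumes L X \<phi> \<psi>"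
    using inv by (auto simp: qsubsumes_def)
  show "qsubsumes L X \<psi> \<phi>"
    using \<pi> \<psi>(3) by (auto simp: qsubsumes_def)
  show "\<psi> \<in> canon ord L ` formulas L"
    unfolding \<psi>_eq using closed[OF \<phi> \<pi>] by (rule imageI)
qed

lemma subsumes_ConjI:
  assumes "\<And>\<psi>. \<psi> \<in> set \<psi>s \<Longrightarrow> \<exists>\<phi>\<in>set \<phi>s. subsumes L \<phi> \<psi>"
  shows "subsumes (LConj L) (Conj \<phi>s) (Conj \<psi>s)"
proof -
  have "\<forall>i. \<exists>j. i < length \<psi>s \<longrightarrow> j < length \<phi>s \<and> subsumes L (\<phi>s ! j) (\<psi>s ! i)"
    using assms by (metis in_set_conv_nth)
  then obtain m where "\<forall>i<length \<psi>s. m i < length \<phi>s \<and> subsumes L (\<phi>s ! m i) (\<psi>s ! i)"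
    by metis
  then show ?thesis
    by (auto intro!: exI[of _ m])
qed

text \<open>Equal multisets give a permutation of positions; it is the injection required in one
  direction, and its inverse is the one for the other.\<close>

lemma subsumes_Disj_mset:
  assumes "mset \<psi>s = mset (map f \<phi>s)"
  shows "(\<And>\<phi>. \<phi> \<in> set \<phi>s \<Longrightarrow> subsumes L \<phi> (f \<phi>)) \<Longrightarrow> subsumes (LDisj k L) (Disj \<phi>s) (Disj \<psi>s)"
    and "(\<And>\<phi>. \<phi> \<in> set \<phi>s \<Longrightarrow> subsumes L (f \<phi>) \<phi>) \<Longrightarrow> subsumes (LDisj k L) (Disj \<psi>s) (Disj \<phi>s)"
proof -
  obtain p where p: "p permutes {..<length \<phi>s}" "permute_list p (map f \<phi>s) = \<psi>s"
    using mset_eq_permutation[OF assms] by auto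
  have len: "length \<psi>s = length \<phi>s"
    using p(2) by auto
  have nth: "\<psi>s ! i = f (\<phi>s ! p i)" if "i < length \<phi>s" for i
    using permute_list_nth[of p "map f \<phi>s" i] p permutes_in_image[OF p(1), of i] that by auto
  have img: "p ` {..<length \<phi>s} = {..<length \<phi>s}" "inv p ` {..<length \<phi>s} = {..<length \<phi>s}"
    using permutes_image[OF p(1)] permutes_image[OF permutes_inv[OF p(1)]] by auto
  have inj: "inj_on p A" "inj_on (inv p) A" for A
    using permutes_inj[OF p(1)] permutes_inj[OF permutes_inv[OF p(1)]] inj_on_subset by blast+
  have less: "p i < length \<phi>s" "inv p i < length \<phi>s" if "i < length \<phi>s" for i
    using that img by blast+
  have inv: "p (inv p i) = i" for i
    using permutes_inverses(1)[OF p(1)] .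
  {
    assume "\<And>\<phi>. \<phi> \<in> set \<phi>s \<Longrightarrow> subsumes L \<phi> (f \<phi>)"
    then have "\<forall>i<length \<phi>s. subsumes L (\<phi>s ! i) (\<psi>s ! inv p i)"
      using nth less inv by simp
    then show "subsumes (LDisj k L) (Disj \<phi>s) (Disj \<psi>s)"
      using img inj len unfolding subsumes.simps
      by - (rule exI[of _ \<phi>s], rule exI[of _ \<psi>s], rule exI[of _ "inv p"], simp)
  }
  {
    assume "\<And>\<phi>. \<phi> \<in> set \<phi>s \<Longrightarrow> subsumes L (f \<phi>) \<phi>"
    then have "\<forall>i<length \<phi>s. subsumes L (\<psi>s ! i) (\<phi>s ! p i)"
      using nth less by simp
    then show "subsumes (LDisj k L) (Disj \<psi>s) (Disj \<phi>s)"
      using img inj len unfolding subsumes.simps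
      by - (rule exI[of _ \<psi>s], rule exI[of _ \<phi>s], rule exI[of _ p], simp)
  }
qed

text \<open>Membership has to be proved together with the two subsumptions: sorted lists and least
  elements are well defined only once the canonical parts are known to lie in the language, where
  the order is linear.\<close>

lemma canon_formulas:
  assumes ord: "\<And>A. base_set S V A \<Longrightarrow> is_base_order A (ord A)"
  shows "bounded_language S V L \<Longrightarrow> \<phi> \<in> formulas L \<Longrightarrow> canon ord L \<phi> \<in> formulas L \<and>
    subsumes L \<phi> (canon ord L \<phi>) \<and> subsumes L (canon ord L \<phi>) \<phi>"
proof (induction L arbitrary: \<phi>)
  case (LBase A)
  then show ?case by simp
next
  case (LOr L1 L2)
  then show ?case by auto
next
  case (LAnd L1 L2)
  then show ?case by auto
next
  case (LDisj k L)
  then obtain \<phi>s where \<phi>: "\<phi> = Disj \<phi>s" "set \<phi>s \<subseteq> formulas L" "length \<phi>s \<le> k"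
    by auto
  let ?\<psi>s = "ascending (leq ord L) (mset (map (canon ord L) \<phi>s))"
  have IH: "\<chi> \<in> formulas L \<Longrightarrow> canon ord L \<chi> \<in> formulas L \<and>
      subsumes L \<chi> (canon ord L \<chi>) \<and> subsumes L (canon ord L \<chi>) \<chi>" for \<chi>
    using LDisj by simp
  have \<psi>s: "mset ?\<psi>s = mset (map (canon ord L) \<phi>s)"
    using linear_on_leq[of S V ord L] ord LDisj.prems(1) \<phi>(2) IH by (intro mset_ascending[of "formulas L"]) auto
  have "set ?\<psi>s = canon ord L ` set \<phi>s" "length ?\<psi>s = length \<phi>s"
    using mset_eq_setD[OF \<psi>s] mset_eq_length[OF \<psi>s] by simp_all
  then have "Disj ?\<psi>s \<in> formulas (LDisj k L)"
    using \<phi> IH by auto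
  then show ?case
    using subsumes_Disj_mset[OF \<psi>s] \<phi>(1,2) IH by (simp del: subsumes.simps) blast
next
  case (LConj L)
  then obtain \<phi>s where \<phi>: "\<phi> = Conj \<phi>s" "set \<phi>s \<subseteq> formulas L" "\<phi>s \<noteq> []"
    by auto
  let ?B = "canon ord L ` set \<phi>s"
  let ?\<psi>s = "ascending (leq ord L) (mset_set (minimal (subsumes L) ?B))"
  have IH: "\<chi> \<in> formulas L \<Longrightarrow> canon ord L \<chi> \<in> formulas L \<and>
      subsumes L \<chi> (canon ord L \<chi>) \<and> subsumes L (canon ord L \<chi>) \<chi>" for \<chi>
    using LConj by simp
  have B: "?B \<subseteq> formulas L" "minimal (subsumes L) ?B \<subseteq> ?B"
    using IH \<phi>(2) by (auto simp: minimal_def)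
  then have fin: "finite (minimal (subsumes L) ?B)"
    by (meson List.finite_set finite_imageI finite_subset)
  have "mset ?\<psi>s = mset_set (minimal (subsumes L) ?B)"
    using linear_on_leq[of S V ord L] ord LConj.prems(1) B fin by (intro mset_ascending[of "formulas L"]) auto
  then have set_\<psi>s: "set ?\<psi>s = minimal (subsumes L) ?B"
    using fin by (metis finite_set_mset_mset_set set_mset_mset)
  \<comment> \<open>Dropping conjuncts that are not minimal loses nothing, since a kept conjunct
    lies below each of them.\<close>
  have below: "\<exists>\<psi>\<in>set ?\<psi>s. subsumes L \<psi> \<chi>" if "\<chi> \<in> set \<phi>s" for \<chi>
  proof -
    have "\<exists>\<psi>\<in>minimal (subsumes L) ?B. subsumes L \<psi> (canon ord L \<chi>)"
    proof (rule minimal_below)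
      show "subsumes L x z" if "x \<in> ?B" "y \<in> ?B" "z \<in> ?B" "subsumes L x y" "subsumes L y z" for x y z
        using that B(1) subsumes_trans[of S V L x y z] LConj.prems(1) by auto
    qed (use B(1) that subsumes_refl in auto)
    then obtain \<psi> where \<psi>: "\<psi> \<in> set ?\<psi>s" "subsumes L \<psi> (canon ord L \<chi>)"
      using set_\<psi>s by auto
    moreover have "\<psi> \<in> formulas L" "\<chi> \<in> formulas L"
      using \<psi>(1) set_\<psi>s B that \<phi>(2) by auto
    ultimately show ?thesis
      using IH[of \<chi>] subsumes_trans[of S V L \<psi> "canon ord L \<chi>" \<chi>] LConj.prems(1) by auto
  qed
  \<comment> \<open>The language contains no empty conjunction, so some minimal conjunct must
    remain.\<close>
  have "?\<psi>s \<noteq> []"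
    using below \<phi>(3) by (metis equals0D list.set(1) list.set_intros(1) neq_Nil_conv)
  then have "Conj ?\<psi>s \<in> formulas (LConj L)"
    using set_\<psi>s B by auto
  moreover have "subsumes (LConj L) (Conj \<phi>s) (Conj ?\<psi>s)"
  proof (rule subsumes_ConjI)
    fix \<psi> assume "\<psi> \<in> set ?\<psi>s"
    then have "\<psi> \<in> ?B"
      using set_\<psi>s B(2) by blast
    then show "\<exists>\<chi>\<in>set \<phi>s. subsumes L \<chi> \<psi>"
      using IH \<phi>(2) by blast
  qed
  moreover have "subsumes (LConj L) (Conj ?\<psi>s) (Conj \<phi>s)"
    by (rule subsumes_ConjI) (rule below)
  ultimately show ?case
    using \<phi>(1) by simp
next
  case (LExists X L)
  then obtain \<phi>' where \<phi>: "\<phi> = Exists X \<phi>'" "\<phi>' \<in> formulas L"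
    by auto
  have X: "bounded_language S V L" "renamable X L" "finite X" "X \<subseteq> V"
    using LExists.prems(1) by simp_all
  note IH = LExists.IH[OF X(1)]
  let ?\<psi> = "least (leq ord L) {canon ord L (rename \<pi> \<phi>') |\<pi>. \<pi> permutes X}"
  have least: "?\<psi> \<in> canon ord L ` formulas L" "qsubsumes L X \<phi>' ?\<psi>" "qsubsumes L X ?\<psi> \<phi>'"
    by (rule least_renaming[OF ord X IH \<phi>(2)]; assumption)+
  have "?\<psi> \<in> formulas L"
    using least(1) by (rule imageE) (erule ssubst, rule IH[THEN conjunct1])
  then show ?case
    using least(2,3) by (simp add: \<phi>(1) del: subsumes.simps)
next
  case (LForall X L)
  then obtain \<phi>' where \<phi>: "\<phi> = Forall X \<phi>'" "\<phi>' \<in> formulas L"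
    by auto
  have X: "bounded_language S V L" "renamable X L" "finite X" "X \<subseteq> V"
    using LForall.prems(1) by simp_all
  note IH = LForall.IH[OF X(1)]
  let ?\<psi> = "least (leq ord L) {canon ord L (rename \<pi> \<phi>') |\<pi>. \<pi> permutes X}"
  have least: "?\<psi> \<in> canon ord L ` formulas L" "qsubsumes L X \<phi>' ?\<psi>" "qsubsumes L X ?\<psi> \<phi>'"
    by (rule least_renaming[OF ord X IH \<phi>(2)]; assumption)+
  have "?\<psi> \<in> formulas L"
    using least(1) by (rule imageE) (erule ssubst, rule IH[THEN conjunct1])
  then show ?case
    using least(2,3) by (simp add: \<phi>(1) del: subsumes.simps)
next
  case (LExFa X L)
  then obtain \<phi>' where \<phi>: "\<phi> = Exists X \<phi>' \<or> \<phi> = Forall X \<phi>'" "\<phi>' \<in> formulas L"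
    by auto
  have X: "bounded_language S V L" "renamable X L" "finite X" "X \<subseteq> V"
    using LExFa.prems(1) by simp_all
  note IH = LExFa.IH[OF X(1)]
  let ?\<psi> = "least (leq ord L) {canon ord L (rename \<pi> \<phi>') |\<pi>. \<pi> permutes X}"
  have least: "?\<psi> \<in> canon ord L ` formulas L" "qsubsumes L X \<phi>' ?\<psi>" "qsubsumes L X ?\<psi> \<phi>'"
    by (rule least_renaming[OF ord X IH \<phi>(2)]; assumption)+
  have "?\<psi> \<in> formulas L"
    using least(1) by (rule imageE) (erule ssubst, rule IH[THEN conjunct1])
  then show ?case
    using \<phi>(1) least(2,3) by (elim disjE) (simp_all del: subsumes.simps)
qed

text \<open>Disjunctions are finite in number by the length bound. For conjunctions the canonical
  form is a function of a subset of the finitely many canonical forms of \<open>L\<close>, and for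
  quantifiers the canonical body is again one of these.\<close>

lemma finite_canon:
  assumes ord: "\<And>A. base_set S V A \<Longrightarrow> is_base_order A (ord A)"
  shows "bounded_language S V L \<Longrightarrow> finite (canon ord L ` formulas L)"
proof (induction L)
  case (LBase A)
  then show ?case by (simp add: base_set_def)
next
  case (LOr L1 L2)
  let ?C = "canon ord L1 ` formulas L1 \<times> canon ord L2 ` formulas L2"
  have "canon ord (LOr L1 L2) ` formulas (LOr L1 L2) \<subseteq> (\<lambda>p. Or (fst p) (snd p)) ` ?C"
    by force
  then show ?case
    by (rule finite_subset) (use LOr in simp)
next
  case (LAnd L1 L2)
  let ?C = "canon ord L1 ` formulas L1 \<times> canon ord L2 ` formulas L2"
  have "canon ord (LAnd L1 L2) ` formulas (LAnd L1 L2) \<subseteq> (\<lambda>p. And (fst p) (snd p)) ` ?C"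
    by force
  then show ?case
    by (rule finite_subset) (use LAnd in simp)
next
  case (LDisj k L)
  let ?lists = "{\<phi>s. set \<phi>s \<subseteq> canon ord L ` formulas L \<and> length \<phi>s \<le> k}"
  have "canon ord (LDisj k L) ` formulas (LDisj k L)
      \<subseteq> (\<lambda>\<phi>s. Disj (ascending (leq ord L) (mset \<phi>s))) ` ?lists"
  proof
    fix \<psi> assume "\<psi> \<in> canon ord (LDisj k L) ` formulas (LDisj k L)"
    then obtain \<phi>s where "set \<phi>s \<subseteq> formulas L" "length \<phi>s \<le> k"
        "\<psi> = Disj (ascending (leq ord L) (mset (map (canon ord L) \<phi>s)))"
      by auto
    then show "\<psi> \<in> (\<lambda>\<phi>s. Disj (ascending (leq ord L) (mset \<phi>s))) ` ?lists"
      by (intro image_eqI[of _ _ "map (canon ord L) \<phi>s"]) auto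
  qed
  then show ?case
    by (rule finite_subset) (use LDisj in \<open>simp add: finite_lists_length_le\<close>)
next
  case (LConj L)
  let ?sets = "Pow (canon ord L ` formulas L)"
  have "canon ord (LConj L) ` formulas (LConj L)
      \<subseteq> (\<lambda>B. Conj (ascending (leq ord L) (mset_set (minimal (subsumes L) B)))) ` ?sets"
    by (auto intro!: imageI)
  then show ?case
    by (rule finite_subset) (use LConj in simp)
next
  case (LExists X L)
  then have X: "bounded_language S V L" "renamable X L" "finite X" "X \<subseteq> V"
    by simp_all
  have "canon ord (LExists X L) ` formulas (LExists X L)
      \<subseteq> Exists X ` canon ord L ` formulas L"
    using least_renaming(1)[OF ord X canon_formulas[OF ord X(1)]] by auto
  then show ?case
    by (rule finite_subset) (use LExists in simp)
next
  case (LForall X L)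
  then have X: "bounded_language S V L" "renamable X L" "finite X" "X \<subseteq> V"
    by simp_all
  have "canon ord (LForall X L) ` formulas (LForall X L)
      \<subseteq> Forall X ` canon ord L ` formulas L"
    using least_renaming(1)[OF ord X canon_formulas[OF ord X(1)]] by auto
  then show ?case
    by (rule finite_subset) (use LForall in simp)
next
  case (LExFa X L)
  then have X: "bounded_language S V L" "renamable X L" "finite X" "X \<subseteq> V"
    by simp_all
  have "canon ord (LExFa X L) ` formulas (LExFa X L)
      \<subseteq> Exists X ` canon ord L ` formulas L \<union> Forall X ` canon ord L ` formulas L"
    using least_renaming(1)[OF ord X canon_formulas[OF ord X(1)]] by auto
  then show ?case
    by (rule finite_subset) (use LExFa in simp)
qed

section \<open>Comparison of the two sets of minimal elements\<close>

theorem theorem5: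
  fixes S :: "('f, 'p) signature" and V :: "'v set" and L :: "('f, 'p, 'v) lang"
    and ord :: "('f, 'p, 'v) fm set \<Rightarrow> ('f, 'p, 'v) fm rel"
    and F :: "('f, 'p, 'v) fm set" and s :: "('f, 'p, 'v, 'u) state"
  assumes "\<And>A. base_set S V A \<Longrightarrow> is_base_order A (ord A)"
    and "bounded_language S V L"
    and "F \<subseteq> formulas L" and "upward_closed L F"
    and "is_state S V s"
  shows "representation ord L (F \<inter> {\<phi> \<in> formulas L. s \<Turnstile> \<phi>}) =
    minimal (subsumes L) (\<Union>\<phi>\<in>representation ord L F. weaken ord L \<phi> s)"
proof -
  let ?c = "canon ord L" and ?sub = "subsumes L"
  define B where "B = {?c \<phi> |\<phi>. \<phi> \<in> F \<inter> {\<phi> \<in> formulas L. s \<Turnstile> \<phi>}}"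
  define U where "U = (\<Union>\<phi>\<in>representation ord L F. weaken ord L \<phi> s)"
  note canon = canon_formulas[OF assms(1,2)]
  note trans = subsumes_trans[OF assms(2)]
  \<comment> \<open>Applied to two sets of canonical forms: those of \<open>F\<close>, which yields
    an element of the representation, and \<open>B\<close>, which yields a minimal element of
    \<open>B\<close>.\<close>
  have below: "\<exists>x\<in>minimal ?sub C. ?sub x y" if C: "C \<subseteq> ?c ` formulas L" and y: "y \<in> C" for C y
  proof (rule minimal_below)
    have C': "C \<subseteq> formulas L"
      using C canon by blast
    show "finite C"
      using finite_canon[OF assms(1,2)] C by (rule rev_finite_subset)
    show "?sub x x" if "x \<in> C" for x
      using that C' subsumes_refl by blast
    show "?sub x z" if "x \<in> C" "y \<in> C" "z \<in> C" "?sub x y" "?sub y z" for x y z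
      using trans[of x y z] that C' by blast
  qed (rule y)
  \<comment> \<open>A formula subsumes its canonical form, so an upward closed set contains the
    canonical forms of its elements.\<close>
  have R_in_F: "\<phi> \<in> F" if "\<phi> \<in> representation ord L F" for \<phi>
  proof -
    obtain \<psi> where "\<psi> \<in> F" "\<phi> = ?c \<psi>"
      using \<open>\<phi> \<in> representation ord L F\<close> by (auto simp: representation_def minimal_def)
    then show ?thesis
      using assms(3,4) canon[of \<psi>] unfolding upward_closed_def by blast
  qed
  have B_formulas: "B \<subseteq> ?c ` formulas L" "B \<subseteq> formulas L"
    using canon by (auto simp: B_def)
  have "U \<subseteq> B"
  proof
    fix x assume "x \<in> U"
    then obtain \<phi> \<psi> where \<phi>: "\<phi> \<in> F" and \<psi>: "\<psi> \<in> formulas L" "?sub \<phi> \<psi>" "s \<Turnstile> \<psi>" "x = ?c \<psi>"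
      using R_in_F by (auto simp: U_def weaken_def minimal_def)
    then have "\<psi> \<in> F"
      using assms(4) unfolding upward_closed_def by blast
    with \<psi> show "x \<in> B"
      by (auto simp: B_def)
  qed
  have "minimal ?sub B \<subseteq> U"
  proof
    fix x assume x: "x \<in> minimal ?sub B"
    then obtain \<psi> where \<psi>: "\<psi> \<in> F" "\<psi> \<in> formulas L" "s \<Turnstile> \<psi>" "x = ?c \<psi>"
      by (auto simp: minimal_def B_def)
    then have "\<exists>\<phi>\<in>representation ord L F. ?sub \<phi> x"
      unfolding representation_def using assms(3) by (intro below) auto
    then obtain \<phi> where \<phi>: "\<phi> \<in> representation ord L F" "?sub \<phi> x"
      by blast
    \<comment> \<open>The weakened set is formed from formulas that hold in \<open>s\<close> and lie
      above \<open>\<phi>\<close>. The formula known to hold is \<open>\<psi>\<close>, so the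
      subsumption of \<open>x\<close> is passed on to \<open>\<psi>\<close>, which its canonical
      form \<open>x\<close> subsumes.\<close>
    have "?sub \<phi> \<psi>"
      using trans[of \<phi> x \<psi>] \<phi> R_in_F assms(3) \<psi> canon[of \<psi>] by blast
    \<comment> \<open>\<open>x\<close> is minimal in \<open>B\<close>; since it lies in the subset
      \<open>W\<close>, it is also minimal there and thus a result of weakening
      \<open>\<phi>\<close>.\<close>
    define W where "W = {?c \<psi> |\<psi>. \<psi> \<in> formulas L \<and> ?sub \<phi> \<psi> \<and> s \<Turnstile> \<psi>}"
    have "W \<subseteq> B"
    proof
      fix y assume "y \<in> W"
      then obtain \<chi> where "\<chi> \<in> formulas L" "?sub \<phi> \<chi>" "s \<Turnstile> \<chi>" "y = ?c \<chi>"
        by (auto simp: W_def)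
      moreover from this have "\<chi> \<in> F"
        using assms(4) R_in_F[OF \<phi>(1)] unfolding upward_closed_def by blast
      ultimately show "y \<in> B"
        by (auto simp: B_def)
    qed
    moreover have "x \<in> W"
      using \<psi> \<open>?sub \<phi> \<psi>\<close> by (auto simp: W_def)
    ultimately have "x \<in> weaken ord L \<phi> s"
      unfolding weaken_def W_def[symmetric] using x by (auto simp: minimal_def)
    then show "x \<in> U"
      using \<phi>(1) by (auto simp: U_def)
  qed
  have "minimal ?sub B = minimal ?sub U"
  proof
    show "minimal ?sub B \<subseteq> minimal ?sub U"
      using \<open>minimal ?sub B \<subseteq> U\<close> \<open>U \<subseteq> B\<close> by (auto simp: minimal_def)
    show "minimal ?sub U \<subseteq> minimal ?sub B"
    proof
      fix x assume x: "x \<in> minimal ?sub U"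
      then have xB: "x \<in> B"
        using \<open>U \<subseteq> B\<close> by (auto simp: minimal_def)
      \<comment> \<open>A minimal element \<open>z\<close> of \<open>B\<close> below
        \<open>y\<close> lies in \<open>U\<close> and below \<open>x\<close>. Minimality of
        \<open>x\<close> in \<open>U\<close> then puts \<open>x\<close> below \<open>z\<close>, and
        hence below \<open>y\<close>.\<close>
      moreover have "?sub x y" if y: "y \<in> B" "?sub y x" for y
      proof -
        obtain z where z: "z \<in> minimal ?sub B" "?sub z y"
          using below[OF B_formulas(1) y(1)] by blast
        then have zU: "z \<in> U" and zB: "z \<in> B"
          using \<open>minimal ?sub B \<subseteq> U\<close> by (auto simp: minimal_def)
        have "?sub z x"
          using trans[of z y x] z(2) y zB xB B_formulas(2) by blast
        then have "?sub x z"
          using x zU by (auto simp: minimal_def)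
        then show "?sub x y"
          using trans[of x z y] z(2) y(1) zB xB B_formulas(2) by blast
      qed
      ultimately show "x \<in> minimal ?sub B"
        by (auto simp: minimal_def)
    qed
  qed
  then show ?thesis
    by (simp add: representation_def B_def U_def)
qed

end
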